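(* Let $K$ be a smooth strictly convex body in $\mathbb{R}^{d+2}$ and let $s_c$ be a $K$-stereographic projection. Let $A=\{a_1,\dots,a_n\}\subset\mathbb{R}^d$ be a configuration of $n\ge d+2$ labeled points in general position that is the vertex set of a $k$-neighborly $d$-polytope $P$, and let $\widehat A\subset\mathbb{R}^{d+1}$ be a $K$-lifting of $A$ (with respect to $s_c$). Then $\widehat P:=\operatorname{conv}(\widehat A)$ is a $k$-neighborly polytope with vertex set $\widehat A$, and the $K$-Delaunay triangulation of $\widehat A$ is a $(k+1)$-neighborly triangulation.
   Context: Basic notions: a configuration in $\mathbb{R}^d$ is in general position if no $d+1$ of its points lie in a common hyperplane. A polytope is $k$-neighborly if every subset of $k$ of its vertices is the vertex set of a face. A triangulation of a point configuration $X$ is a collection of simplices (cells) with vertices in $X$, closed under taking faces, that cover $\operatorname{conv}(X)$ and such that any two intersect in a common face; it is $\ell$-neighborly if $\operatorname{conv}(S)$ is a cell for every $S\subset X$ with $|S|=\ell$. Smooth strictly convex body: a convex body is a full-dimensional compact convex set; it is strictly convex if its boundary contains no segment, and smooth if every boundary point has a unique supporting hyperplane. $K$-stereographic projection: let $K\subset\mathbb{R}^{m+1}$ be a smooth strictly convex body, $c\in\partial K$, and $H_c\cong\mathbb{R}^m$ a translate, not containing $c$, of the supporting hyperplane of $K$ at $c$ (canonically chosen tangent to $K$). The $K$-stereographic projection with center $c$ is the bijection $s_c:\partial K\setminus\{c\}\to H_c\cong\mathbb{R}^m$ sending $x$ to the intersection of the line $cx$ with $H_c$; the same central projection from $c$ is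 applied to any other point of $K\setminus\{c\}$. For a hyperplane $H\subset\mathbb{R}^{m+1}$ not containing $c$ (and meeting $K$), $s_c(H\cap\partial K)$ is a $K$-sphere and it bounds the $K$-ball $s_c(H\cap K)\subset\mathbb{R}^m$. If $b_1,\dots,b_{m+1}\in\mathbb{R}^m$ are affinely independent, then $s_c^{-1}(b_1),\dots,s_c^{-1}(b_{m+1})$ span a hyperplane $H$ not containing $c$; then $s_c(H\cap K)$ is the $K$-circumball spanned by $b_1,\dots,b_{m+1}$. $K$-Delaunay: for a configuration $X\subset\mathbb{R}^m$, the $K$-Delaunay subdivision $\mathcal{D}_K(X)$ consists of the cells $\operatorname{conv}(S)$, $S\subseteq X$, for which there is a $K$-sphere containing $S$ such that all points of $X\setminus S$ lie outside the corresponding $K$-ball. If it is a triangulation, it is called the $K$-Delaunay triangulation. Liftings: for a hyperplane $H=\{x:\langle x,v\rangle=t\}$ with normal vector $v$ whose last coordinate is positive, a point $a$ is above (resp. below) $H$ if $\langle a,v\rangle>t$ (resp. $<t$). A lex-lifting of $A=\{a_1,\dots,a_n\}\subset\mathbb{R}^d$ is a labeled configuration $\widehat A=\{\widehat a_1,\dots,\widehat a_n\}\subset\mathbb{R}^{d+1}$, $\widehat a_i=(a_i,h_i)$ with $h_i\in\mathbb{R}$, such that for each $i\ge d+2$ one has $h_i\ne0$ and $|h_i|$ is large enough that $\widehat a_i$ is above (if $h_i>0$) or below (if $h_i<0$) every hyperplane spanned by points of $\{\widehat a_1,\dots,\widehat a_{i-1}\}$. Given $K\subset\mathbb{R}^{d+2}$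 and $s_c$ (so $m=d+1$), a $K$-lifting of $A$ is a lex-lifting $\widehat A$ such that moreover, for each $i>d+2$, $\widehat a_i$ is not contained in any $K$-circumball spanned by points of $\{\widehat a_1,\dots,\widehat a_{i-1}\}$. *)

theory Defs
  imports "HOL-Analysis.Analysis"
begin

definition hyperplane :: "'v::euclidean_space set \<Rightarrow> bool" where
  "hyperplane H \<longleftrightarrow> (\<exists>u t. u \<noteq> 0 \<and> H = {x. u \<bullet> x = t})"

section \<open>Configurations, neighborly polytopes and triangulations\<close>

definition general_position :: "'v::euclidean_space set \<Rightarrow> bool" where
  "general_position A \<longleftrightarrow>
     (\<forall>S\<subseteq>A. card S = DIM('v) + 1 \<longrightarrow> \<not> (\<exists>H. hyperplane H \<and> S \<subseteq> H))"

definition vertices :: "'v::euclidean_space set \<Rightarrow> 'v set" where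
  "vertices P = {v. v extreme_point_of P}"

text \<open>As with \<^const>\<open>face_of\<close>, the empty face and the polytope itself count as faces.\<close>

definition neighborly_polytope :: "nat \<Rightarrow> 'v::euclidean_space set \<Rightarrow> bool" where
  "neighborly_polytope k P \<longleftrightarrow>
     polytope P \<and>
     (\<forall>S\<subseteq>vertices P. card S = k \<longrightarrow> (\<exists>F. F face_of P \<and> vertices F = S))"

text \<open>The library constant \<^const>\<open>triangulation\<close> does not require closure under faces,
  whereas \<^const>\<open>simplicial_complex\<close> does; the empty simplex is a cell.\<close>

definition triangulation_of :: "'v::euclidean_space set \<Rightarrow> 'v set set \<Rightarrow> bool" where
  "triangulation_of X T \<longleftrightarrow>
     simplicial_complex T \<and> (\<forall>C\<in>T. vertices C \<subseteq> X) \<and> \<Union>T = convex hull X"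

definition neighborly_triangulation ::
    "nat \<Rightarrow> 'v::euclidean_space set \<Rightarrow> 'v set set \<Rightarrow> bool" where
  "neighborly_triangulation l X T \<longleftrightarrow>
     triangulation_of X T \<and> (\<forall>S\<subseteq>X. card S = l \<longrightarrow> convex hull S \<in> T)"

section \<open>Smooth strictly convex bodies\<close>

definition convex_body :: "'v::euclidean_space set \<Rightarrow> bool" where
  "convex_body K \<longleftrightarrow> convex K \<and> compact K \<and> interior K \<noteq> {}"

definition strictly_convex_body :: "'v::euclidean_space set \<Rightarrow> bool" where
  "strictly_convex_body K \<longleftrightarrow>
     convex_body K \<and> \<not> (\<exists>x y. x \<noteq> y \<and> closed_segment x y \<subseteq> frontier K)"

definition supporting_hyperplane ::
    "'v::euclidean_space set \<Rightarrow> 'v \<Rightarrow> 'v set \<Rightarrow> bool" where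
  "supporting_hyperplane K x H \<longleftrightarrow>
     (\<exists>u t. u \<noteq> 0 \<and> H = {y. u \<bullet> y = t} \<and> x \<in> H \<and> (\<forall>y\<in>K. u \<bullet> y \<le> t))"

definition smooth_body :: "'v::euclidean_space set \<Rightarrow> bool" where
  "smooth_body K \<longleftrightarrow>
     convex_body K \<and> (\<forall>x\<in>frontier K. \<exists>!H. supporting_hyperplane K x H)"

section \<open>Stereographic projection\<close>

text \<open>The identification of \<open>\<real>\<^sup>m\<close> with the hyperplane \<open>H\<^sub>c\<close> is an affine
  isomorphism \<open>\<phi>\<close> of \<open>\<real>\<^sup>m\<close> onto \<open>H\<^sub>c\<close>, so \<open>H\<^sub>c = range \<phi>\<close>.  Any translate
  of the supporting hyperplane at \<open>c\<close> that avoids \<open>c\<close> and any affine coordinates on it are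
  allowed.\<close>

definition stereographic_chart ::
    "'e::euclidean_space set \<Rightarrow> 'e \<Rightarrow> ('m::euclidean_space \<Rightarrow> 'e) \<Rightarrow> bool" where
  "stereographic_chart K c \<phi> \<longleftrightarrow>
     c \<in> frontier K \<and>
     (\<exists>p L. linear L \<and> inj L \<and> \<phi> = (\<lambda>y. p + L y)) \<and>
     (\<exists>H w. supporting_hyperplane K c H \<and> range \<phi> = (\<lambda>x. w + x) ` H) \<and>
     c \<notin> range \<phi>"

text \<open>The central projection from \<open>c\<close>, meaningful on \<open>K - {c}\<close>.\<close>

definition stereo ::
    "'e::euclidean_space \<Rightarrow> ('m::euclidean_space \<Rightarrow> 'e) \<Rightarrow> 'e \<Rightarrow> 'm" where
  "stereo c \<phi> x = (THE y. \<phi> y \<in> affine hull {c, x})"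

definition stereo_inv ::
    "'e::euclidean_space set \<Rightarrow> 'e \<Rightarrow> ('m::euclidean_space \<Rightarrow> 'e) \<Rightarrow> 'm \<Rightarrow> 'e" where
  "stereo_inv K c \<phi> = inv_into (frontier K - {c}) (stereo c \<phi>)"

text \<open>A hyperplane that only touches \<open>K\<close> is allowed and gives a one-point \<open>K\<close>-ball.\<close>

definition cutting_hyperplane ::
    "'e::euclidean_space set \<Rightarrow> 'e \<Rightarrow> 'e set \<Rightarrow> bool" where
  "cutting_hyperplane K c H \<longleftrightarrow> hyperplane H \<and> c \<notin> H \<and> H \<inter> K \<noteq> {}"

definition K_sphere ::
    "'e::euclidean_space set \<Rightarrow> 'e \<Rightarrow> ('m::euclidean_space \<Rightarrow> 'e) \<Rightarrow> 'e set \<Rightarrow> 'm set" where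
  "K_sphere K c \<phi> H = stereo c \<phi> ` (H \<inter> frontier K)"

definition K_ball ::
    "'e::euclidean_space set \<Rightarrow> 'e \<Rightarrow> ('m::euclidean_space \<Rightarrow> 'e) \<Rightarrow> 'e set \<Rightarrow> 'm set" where
  "K_ball K c \<phi> H = stereo c \<phi> ` (H \<inter> K)"

text \<open>Meaningful when \<open>B\<close> consists of \<open>m + 1\<close> affinely independent points of \<open>\<real>\<^sup>m\<close>.\<close>

definition K_circumball ::
    "'e::euclidean_space set \<Rightarrow> 'e \<Rightarrow> ('m::euclidean_space \<Rightarrow> 'e) \<Rightarrow> 'm set \<Rightarrow> 'm set" where
  "K_circumball K c \<phi> B = K_ball K c \<phi> (affine hull (stereo_inv K c \<phi> ` B))"

definition K_Delaunay ::
    "'e::euclidean_space set \<Rightarrow> 'e \<Rightarrow> ('m::euclidean_space \<Rightarrow> 'e) \<Rightarrow> 'm set \<Rightarrow> 'm set set" where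
  "K_Delaunay K c \<phi> X =
     {convex hull S | S. S \<subseteq> X \<and>
        (\<exists>H. cutting_hyperplane K c H \<and> S \<subseteq> K_sphere K c \<phi> H \<and>
             (\<forall>x\<in>X - S. x \<notin> K_ball K c \<phi> H))}"

section \<open>Liftings\<close>

text \<open>With \<open>\<real>\<^sup>d\<close> rendered as \<^typ>\<open>'a::euclidean_space\<close>, the space \<open>\<real>\<^bsup>d+1\<^esup>\<close> is
  \<^typ>\<open>'a::euclidean_space \<times> real\<close>, with last coordinate \<^const>\<open>snd\<close>.\<close>

definition above_hyperplane ::
    "'a::euclidean_space \<times> real \<Rightarrow> ('a \<times> real) set \<Rightarrow> bool" where
  "above_hyperplane p H \<longleftrightarrow> (\<exists>v t. snd v > 0 \<and> H = {x. x \<bullet> v = t} \<and> p \<bullet> v > t)"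

definition below_hyperplane ::
    "'a::euclidean_space \<times> real \<Rightarrow> ('a \<times> real) set \<Rightarrow> bool" where
  "below_hyperplane p H \<longleftrightarrow> (\<exists>v t. snd v > 0 \<and> H = {x. x \<bullet> v = t} \<and> p \<bullet> v < t)"

definition spanned_hyperplane :: "'v::euclidean_space set \<Rightarrow> 'v set \<Rightarrow> bool" where
  "spanned_hyperplane X H \<longleftrightarrow> hyperplane H \<and> (\<exists>T\<subseteq>X. H = affine hull T)"

definition lift :: "(nat \<Rightarrow> 'a) \<Rightarrow> (nat \<Rightarrow> real) \<Rightarrow> nat \<Rightarrow> 'a \<times> real" where
  "lift a h i = (a i, h i)"

text \<open>Configurations are labeled by \<open>{1..n}\<close>.\<close>

definition lex_lifting ::
    "nat \<Rightarrow> (nat \<Rightarrow> 'a::euclidean_space) \<Rightarrow> (nat \<Rightarrow> real) \<Rightarrow> bool" where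
  "lex_lifting n a h \<longleftrightarrow>
     (\<forall>i\<in>{DIM('a) + 2..n}. h i \<noteq> 0 \<and>
        (\<forall>H. spanned_hyperplane (lift a h ` {1..<i}) H \<longrightarrow>
           (h i > 0 \<longrightarrow> above_hyperplane (lift a h i) H) \<and>
           (h i < 0 \<longrightarrow> below_hyperplane (lift a h i) H)))"

definition K_lifting ::
    "'e::euclidean_space set \<Rightarrow> 'e \<Rightarrow> ('a::euclidean_space \<times> real \<Rightarrow> 'e) \<Rightarrow>
     nat \<Rightarrow> (nat \<Rightarrow> 'a) \<Rightarrow> (nat \<Rightarrow> real) \<Rightarrow> bool" where
  "K_lifting K c \<phi> n a h \<longleftrightarrow>
     lex_lifting n a h \<and>
     (\<forall>i\<in>{DIM('a) + 3..n}. \<forall>B\<subseteq>lift a h ` {1..<i}.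
        card B = DIM('a) + 2 \<and> \<not> affine_dependent B \<longrightarrow>
        lift a h i \<notin> K_circumball K c \<phi> B)"

end

theory Submission
  imports Defs
begin

text \<open>
  The central projection from \<open>c\<close> extends to a projective map that sends the supporting hyperplane at
  \<open>c\<close> to infinity.  It turns \<open>K\<close> into the epigraph of a function \<open>F\<close> on \<open>\<real>\<^bsup>d+1\<^esup>\<close>, the
  projection into the vertical projection, and the hyperplanes that avoid \<open>c\<close> into graphs of affine
  functionals \<open>l\<close>; the \<open>K\<close>-ball of such a hyperplane is the set where \<open>F \<le> l\<close>.  Smoothness makes
  \<open>F\<close> defined everywhere, because every ray from \<open>c\<close> to the inner side of the supporting hyperplane
  enters the interior, and strict convexity makes every point of \<open>K\<close> other than \<open>c\<close> visible to the
  projection.  Consequently the \<open>K\<close>-Delaunay subdivision is the regular subdivision induced by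
  \<open>F\<close> (\<open>K_Delaunay_eq_regular_subdivision\<close>): its cells are spanned by the sets of points at which an
  affine minorant of \<open>F\<close> is tight.

  In these terms a \<open>K\<close>-lifting is a lex-lifting for which \<open>F\<close> is at each new point larger than every
  affine interpolant of \<open>F\<close> on \<open>d + 2\<close> independent earlier points, so that applying \<open>F\<close> is again a
  lex-lifting, one dimension higher and with all signs positive.  The lex condition puts the
  lifted points in general position, and the circumball condition keeps the tight sets affinely
  independent.  A regular subdivision with independent cells is a triangulation
  (\<open>regular_subdivision_triangulation\<close>); that it covers the convex hull is linear programming.

  That the lifted polytope is \<open>k\<close>-neighborly holds because faces of \<open>P\<close> pull back along the vertical
  projection.  For the triangulation (\<open>neighborly_lower_cells\<close>), the points are added one at a
  time.  A cell that is already present survives, as the new point lies outside every circumball.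
  A set of \<open>k + 1\<close> points that contains the new one consists of it and \<open>k\<close> earlier points which
  span a face of \<open>P\<close>.  The lifts of these \<open>k\<close> points lie on both the upper and the lower hull of the
  earlier points, and the new point, being extremely high or low, sees one of these hulls completely.
  So the \<open>k\<close> points lie in a visible face (\<open>visible_functional\<close>), and the new point is joined to
  it.  Both halves of this argument rest on one lemma, \<open>spanning_minorant\<close>: hypotheses about spanned
  hyperplanes extend to all supporting ones, because a minorant can be moved until its tight
  points span.
\<close>

section \<open>Affine functionals\<close>

definition affine_functional :: "('v::euclidean_space \<Rightarrow> real) \<Rightarrow> bool" where
  "affine_functional l \<longleftrightarrow> (\<exists>w b. l = (\<lambda>x. w \<bullet> x + b))"

lemma affine_functional_const [intro]: "affine_functional (\<lambda>x. b)"
  unfolding affine_functional_def by (intro exI[of _ 0] exI[of _ b]) simp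

lemma affine_functional_add [intro]:
  assumes "affine_functional l" "affine_functional m"
  shows "affine_functional (\<lambda>x. l x + m x)"
proof -
  obtain w b w' b' where "l = (\<lambda>x. w \<bullet> x + b)"
    "m = (\<lambda>x. w' \<bullet> x + b')"
    using assms unfolding affine_functional_def by blast
  then have "(\<lambda>x. l x + m x) = (\<lambda>x. (w + w') \<bullet> x + (b + b'))"
    by (simp add: inner_add_left fun_eq_iff)
  then show ?thesis unfolding affine_functional_def by blast
qed

lemma affine_functional_scale [intro]:
  assumes "affine_functional l"
  shows "affine_functional (\<lambda>x. r * l x)"
proof -
  obtain w b where "l = (\<lambda>x. w \<bullet> x + b)"
    using assms unfolding affine_functional_def by blast
  then have "(\<lambda>x. r * l x) = (\<lambda>x. (r *\<^sub>R w) \<bullet> x + r * b)"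
    by (simp add: fun_eq_iff algebra_simps)
  then show ?thesis unfolding affine_functional_def by blast
qed

lemma affine_functional_linear:
  fixes g :: "'v::euclidean_space \<Rightarrow> real"
  assumes "linear g"
  shows "affine_functional g"
proof -
  have "g = (\<lambda>x. adjoint g 1 \<bullet> x + 0)"
    using adjoint_works[OF assms, of _ 1] by (simp add: inner_commute fun_eq_iff)
  then show ?thesis unfolding affine_functional_def by blast
qed

lemma affine_functional_sum:
  assumes "affine_functional l" "sum u S = 1"
  shows "l (\<Sum>v\<in>S. u v *\<^sub>R v) = (\<Sum>v\<in>S. u v * l v)"
proof -
  obtain w b where l: "l = (\<lambda>x. w \<bullet> x + b)"
    using assms unfolding affine_functional_def by blast
  have "(\<Sum>v\<in>S. u v * (w \<bullet> v + b)) = (\<Sum>v\<in>S. u v * (w \<bullet> v)) + sum u S * b"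
    by (simp add: distrib_left sum.distrib sum_distrib_right)
  then show ?thesis using assms(2) by (simp add: l inner_sum_right)
qed

lemma affine_functional_nonpos_hull:
  assumes "affine_functional l" "y \<in> convex hull S"
    "\<And>x. x \<in> S \<Longrightarrow> l x \<le> 0"
  shows "l y \<le> 0"
proof -
  obtain w b where l: "l = (\<lambda>x. w \<bullet> x + b)"
    using assms unfolding affine_functional_def by blast
  have "{x. l x \<le> 0} = {x. w \<bullet> x \<le> - b}" by (auto simp: l)
  then have "convex {x. l x \<le> 0}" using convex_halfspace_le by metis
  then have "convex hull S \<subseteq> {x. l x \<le> 0}"
    by (intro hull_minimal) (use assms(3) in auto)
  then show ?thesis using assms(2) by blast
qed

lemma affine_functional_eq_hull:
  assumes "affine_functional l" "affine_functional m" "y \<in> affine hull S"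
    "\<And>x. x \<in> S \<Longrightarrow> l x = m x"
  shows "l y = m y"
proof -
  have "affine_functional (\<lambda>x. l x + (-1) * m x)"
    by (rule affine_functional_add[OF assms(1) affine_functional_scale[OF assms(2)]])
  then obtain w b where l: "(\<lambda>x. l x + (-1) * m x) = (\<lambda>x. w \<bullet> x + b)"
    unfolding affine_functional_def by blast
  then have l': "l x - m x = w \<bullet> x + b" for x by (auto dest: fun_cong[of _ _ x])
  then have "{x. l x = m x} = {x. w \<bullet> x = - b}"
    by (auto simp: eq_iff_diff_eq_0[of "l _"])
  then have "affine {x. l x = m x}" using affine_hyperplane by metis
  then have "affine hull S \<subseteq> {x. l x = m x}"
    by (intro hull_minimal) (use assms(4) in auto)
  then show ?thesis using assms(3) by blast
qed

text \<open>Translating one point of the affinely independent set to the origin makes the others linearly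
  independent, so that prescribed values on them extend to a linear map.\<close>

lemma affine_interpolation:
  fixes S :: "'v::euclidean_space set"
  assumes "\<not> affine_dependent S"
  shows "\<exists>l. affine_functional l \<and> (\<forall>x\<in>S. l x = F x)"
proof (cases "S = {}")
  case True
  then show ?thesis using affine_functional_const by blast
next
  case False
  then obtain p where p: "p \<in> S" by blast
  have "independent ((+) (- p) ` (S - {p}))"
    using assms affine_dependent_iff_dependent2[OF p] by blast
  from real_vector.linear_independent_extend[OF this, of "\<lambda>z. F (p + z) - F p"]
  obtain g :: "'v \<Rightarrow> real" where g: "linear g"
    "\<And>z. z \<in> (+) (- p) ` (S - {p}) \<Longrightarrow> g z = F (p + z) - F p" by blast
  have lg: "g (x - p) = g x - g p" for x using g(1) by (simp add: linear_diff)
  show ?thesis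
  proof (intro exI[of _ "\<lambda>x. g x + (F p - g p)"] conjI ballI)
    show "affine_functional (\<lambda>x. g x + (F p - g p))"
      by (intro affine_functional_add affine_functional_linear g affine_functional_const)
    fix x assume x: "x \<in> S"
    show "g x + (F p - g p) = F x"
    proof (cases "x = p")
      case False
      then have "g (- p + x) = F (p + (- p + x)) - F p" using x by (intro g(2)) auto
      then show ?thesis using lg[of x] by simp
    qed simp
  qed
qed

lemma small_perturbation:
  fixes p r :: "'v \<Rightarrow> real"
  assumes "finite Y" "\<And>y. y \<in> Y \<Longrightarrow> p y < 0"
  shows "\<exists>e. 0 < e \<and> e < 1 \<and> (\<forall>y\<in>Y. p y + e * r y < 0)"
proof -
  have "eventually (\<lambda>e. p y + e * r y < 0) (at_right 0)" if "y \<in> Y" for y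
  proof -
    have "((\<lambda>e. p y + e * r y) \<longlongrightarrow> p y + 0 * r y) (at_right 0)"
      by (intro tendsto_intros)
    then show ?thesis using assms(2)[OF that] by (intro order_tendstoD(2)) auto
  qed
  then have "eventually (\<lambda>e. \<forall>y\<in>Y. p y + e * r y < 0) (at_right 0)"
    by (intro eventually_ball_finite assms) auto
  moreover have "eventually (\<lambda>e::real. 0 < e \<and> e < 1) (at_right 0)"
    using eventually_at_right_less[of 0] eventually_at_right_real[of 0 1] by auto
  ultimately have "eventually (\<lambda>e. 0 < e \<and> e < 1 \<and> (\<forall>y\<in>Y. p y + e * r y < 0)) (at_right 0)"
    by eventually_elim auto
  then show ?thesis by (rule eventually_happens'[rotated]) simp
qed

section \<open>Minorants and their tight points\<close>

definition tight_points :: "('v \<Rightarrow> real) \<Rightarrow> 'v set \<Rightarrow> ('v \<Rightarrow> real) \<Rightarrow> 'v set" where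
  "tight_points F X l = {x \<in> X. l x = F x}"

definition minorizes :: "('v::euclidean_space \<Rightarrow> real) \<Rightarrow> 'v set \<Rightarrow> ('v \<Rightarrow> real) \<Rightarrow> bool" where
  "minorizes l X F \<longleftrightarrow> affine_functional l \<and> (\<forall>x\<in>X. l x \<le> F x)"

text \<open>The ratio test of the simplex method: moving in the direction \<open>m\<close>, a minorant stays
  below \<open>F\<close> until the first point where \<open>m\<close> is positive becomes tight; the step is
  the smallest of the quotients of slack by slope.\<close>

lemma minorant_push:
  fixes X :: "'v::euclidean_space set"
  assumes "finite X" "minorizes l X F" "affine_functional m" "b \<in> X" "m b > 0"
  obtains s where "s \<ge> 0" "minorizes (\<lambda>x. l x + s * m x) X F"
    "\<exists>x\<in>X. m x > 0 \<and> l x + s * m x = F x"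
proof -
  define Y where "Y = {x \<in> X. m x > 0}"
  have Y: "finite Y" "Y \<noteq> {}" using assms by (auto simp: Y_def)
  define s where "s = Min ((\<lambda>x. (F x - l x) / m x) ` Y)"
  have "s \<in> (\<lambda>x. (F x - l x) / m x) ` Y" unfolding s_def using Y by (intro Min_in) auto
  then obtain x0 where x0: "x0 \<in> Y" "s = (F x0 - l x0) / m x0" by blast
  have sle: "s \<le> (F x - l x) / m x" if "x \<in> Y" for x
    unfolding s_def using Y that by (intro Min_le) auto
  have le: "l x \<le> F x" if "x \<in> X" for x using assms(2) that by (auto simp: minorizes_def)
  have s0: "s \<ge> 0" using x0 le[of x0] by (auto simp: Y_def)
  show ?thesis
  proof (rule that[OF s0])
    have "l x + s * m x \<le> F x" if "x \<in> X" for x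
    proof (cases "m x > 0")
      case True
      then have "s \<le> (F x - l x) / m x" using that sle by (auto simp: Y_def)
      then show ?thesis using True by (simp add: field_simps)
    next
      case False
      then have "s * m x \<le> 0" using s0 by (simp add: mult_nonneg_nonpos)
      then show ?thesis using le[OF that] by simp
    qed
    then show "minorizes (\<lambda>x. l x + s * m x) X F"
      using assms(2,3) by (auto simp: minorizes_def)
    show "\<exists>x\<in>X. m x > 0 \<and> l x + s * m x = F x"
      using x0 by (auto simp: Y_def)
  qed
qed

lemma nonspanning_vanishing_functional:
  fixes T :: "'v::euclidean_space set"
  assumes "affine hull T \<noteq> UNIV" "affine hull X = UNIV"
  obtains m b where "affine_functional m" "\<And>x. x \<in> T \<Longrightarrow> m x = 0" "b \<in> X"
    "m b \<noteq> 0"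
proof -
  have "aff_dim T < DIM('v)"
    using assms(1) aff_dim_eq_full[of T] aff_dim_le_DIM[of T] by linarith
  then obtain w t where w: "w \<noteq> 0" "T \<subseteq> {x. w \<bullet> x = t}"
    by (rule aff_lowdim_subset_hyperplane)
  let ?m = "\<lambda>x. w \<bullet> x + (- t)"
  have m: "affine_functional ?m" unfolding affine_functional_def by blast
  have "\<exists>b\<in>X. ?m b \<noteq> 0"
  proof (rule ccontr)
    assume "\<not> ?thesis"
    then have "X \<subseteq> {x. w \<bullet> x = t}" by auto
    then have "affine hull X \<subseteq> {x. w \<bullet> x = t}"
      by (intro hull_minimal affine_hyperplane)
    then have *: "w \<bullet> x = t" for x using assms(2) by auto
    from *[of w] *[of 0] w(1) show False by simp
  qed
  then show ?thesis using that[OF m] w(2) by auto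
qed

text \<open>The minorants that keep the given tight points form a polyhedron without lines, and a vertex of it
  is a minorant with affinely spanning tight set; choosing the directions well, one reaches such a vertex
  without decreasing the value at \<open>y\<close>. Concretely, take a minorant with as many tight points as
  possible: if they lay in a hyperplane \<open>m = 0\<close>, then pushing along \<open>m\<close> or \<open>-
  m\<close>, whichever is nonnegative at \<open>y\<close> and positive somewhere on \<open>X\<close>, would
  add a tight point. Spanning minorants are interpolants of \<open>F\<close>, which is what hypotheses about
  spanned hyperplanes and circumballs speak about.\<close>

lemma spanning_minorant:
  fixes X :: "'v::euclidean_space set"
  assumes "finite X" "affine hull X = UNIV" "y \<in> convex hull X" "minorizes l0 X F"
  obtains l where "minorizes l X F" "tight_points F X l0 \<subseteq> tight_points F X l"
    "affine hull (tight_points F X l) = UNIV" "l y \<ge> l0 y"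
proof -
  define Q where "Q l \<longleftrightarrow> minorizes l X F \<and> tight_points F X l0 \<subseteq> tight_points F X l \<and> l y \<ge> l0 y" for l
  have "Q l0" using assms by (simp add: Q_def)
  moreover have "card (tight_points F X l) \<le> card X" for l
    using assms(1) by (intro card_mono) (auto simp: tight_points_def)
  ultimately obtain l where l: "Q l" and
    mx: "\<And>l'. Q l' \<Longrightarrow> card (tight_points F X l') \<le> card (tight_points F X l)"
    using ex_has_greatest_nat[of Q l0 "\<lambda>l. card (tight_points F X l)" "card X + 1"]
    by (auto simp: less_Suc_eq_le)
  have "affine hull (tight_points F X l) = UNIV"
  proof (rule ccontr)
    assume "\<not> ?thesis"
    then obtain m b where m: "affine_functional m"
      "\<And>x. x \<in> tight_points F X l \<Longrightarrow> m x = 0"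
      "b \<in> X" "m b \<noteq> 0" using nonspanning_vanishing_functional assms(2) by metis
    \<comment> \<open>Since \<open>y\<close> is in the hull of \<open>X\<close>, a functional positive at \<open>y\<close> is positive somewhere on \<open>X\<close>.\<close>
    have "\<exists>m b. affine_functional m \<and> (\<forall>x \<in> tight_points F X l. m x = 0) \<and> m y \<ge> 0 \<and> b \<in> X \<and> m b > 0"
    proof -
      have neg: "affine_functional (\<lambda>x. - m x)"
        using affine_functional_scale[OF m(1), of "-1"] by simp
      consider "m y > 0" | "m y < 0" | "m y = 0" by linarith
      then show ?thesis
      proof cases
        case 1
        then have "\<exists>b\<in>X. m b > 0" using affine_functional_nonpos_hull[OF m(1) assms(3)]
          by force
        then show ?thesis using 1 m by (intro exI[of _ m]) auto
      next
        case 2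
        then have "\<exists>b\<in>X. - m b > 0"
          using affine_functional_nonpos_hull[OF neg assms(3)] by force
        then show ?thesis using 2 m neg by (intro exI[of _ "\<lambda>x. - m x"]) auto
      next
        case 3
        show ?thesis
        proof (cases "m b > 0")
          case True then show ?thesis using 3 m by (intro exI[of _ m]) auto
        next
          case False then show ?thesis using 3 m neg
            by (intro exI[of _ "\<lambda>x. - m x"] exI[of _ b]) auto
        qed
      qed
    qed
    then obtain m b where m: "affine_functional m"
      "\<And>x. x \<in> tight_points F X l \<Longrightarrow> m x = 0"
      "m y \<ge> 0" "b \<in> X" "m b > 0" by blast
    obtain s where s: "s \<ge> 0" "minorizes (\<lambda>x. l x + s * m x) X F"
      "\<exists>x\<in>X. m x > 0 \<and> l x + s * m x = F x"
      using minorant_push[OF assms(1) _ m(1) m(4) m(5), of l F] l by (auto simp: Q_def)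
    let ?l = "\<lambda>x. l x + s * m x"
    obtain x where x: "x \<in> X" "m x > 0" "?l x = F x" using s by blast
    have sub: "tight_points F X l \<subseteq> tight_points F X ?l"
      using m(2) by (auto simp: tight_points_def)
    have "x \<in> tight_points F X ?l - tight_points F X l"
      using x m(2)[of x] by (auto simp: tight_points_def)
    with sub have "tight_points F X l \<subset> tight_points F X ?l" by blast
    then have "card (tight_points F X l) < card (tight_points F X ?l)"
      using assms(1) by (intro psubset_card_mono) (auto simp: tight_points_def)
    moreover have "Q ?l" using l s sub m(3) unfolding Q_def by (auto intro: order_trans)
    ultimately show False using mx[of ?l] by simp
  qed
  then show ?thesis using that l by (auto simp: Q_def)
qed

text \<open>A spanning minorant is determined by its tight points, so there are finitely many, and one of them
  is largest at \<open>y\<close>. Its tight points must have \<open>y\<close> in their convex hull: otherwise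
  a functional separating \<open>y\<close> from them is a direction in which the minorant can be pushed up,
  and its value at \<open>y\<close> grows.\<close>

lemma tight_hull_covers:
  fixes X :: "'v::euclidean_space set"
  assumes "finite X" "affine hull X = UNIV" "y \<in> convex hull X"
  obtains l where "minorizes l X F" "y \<in> convex hull (tight_points F X l)"
proof -
  define Q where "Q = {l. minorizes l X F \<and> affine hull (tight_points F X l) = UNIV}"
  have "inj_on (tight_points F X) Q"
  proof (rule inj_onI, rule ext)
    fix l l' x assume *: "l \<in> Q" "l' \<in> Q" "tight_points F X l = tight_points F X l'"
    have "l z = l' z" if z: "z \<in> tight_points F X l" for z
    proof -
      have "z \<in> tight_points F X l'" using z *(3) by simp
      then show ?thesis using z by (simp add: tight_points_def)
    qed
    moreover have "affine_functional l" "affine_functional l'"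
      "x \<in> affine hull tight_points F X l"
      using *(1,2) by (simp_all add: Q_def minorizes_def)
    ultimately show "l x = l' x" using affine_functional_eq_hull by blast
  qed
  moreover have "finite (tight_points F X ` Q)"
    by (rule finite_subset[of _ "Pow X"]) (use assms(1) in \<open>auto simp: tight_points_def\<close>)
  ultimately have finQ: "finite Q" by (rule finite_imageD[rotated])
  have "minorizes (\<lambda>_. Min (F ` X)) X F"
    using assms(1) affine_functional_const by (simp add: minorizes_def)
  then obtain l1 where "l1 \<in> Q"
    using spanning_minorant[OF assms(1,2,3)] unfolding Q_def by (metis (mono_tags) mem_Collect_eq)
  then have "(\<lambda>l. l y) ` Q \<noteq> {}" by blast
  then have "Max ((\<lambda>l. l y) ` Q) \<in> (\<lambda>l. l y) ` Q" using finQ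
    by (intro Max_in) auto
  then obtain l where l: "l \<in> Q" and max: "Max ((\<lambda>l. l y) ` Q) = l y" by blast
  have mx: "l' y \<le> l y" if "l' \<in> Q" for l'
    unfolding max[symmetric] using finQ that by (intro Max_ge) auto
  let ?T = "tight_points F X l"
  have "y \<in> convex hull ?T"
  proof (rule ccontr)
    assume "y \<notin> convex hull ?T"
    moreover have "closed (convex hull ?T)"
      using assms(1) by (intro compact_imp_closed finite_imp_compact_convex_hull)
        (auto simp: tight_points_def)
    ultimately obtain w t where w: "w \<bullet> y < t"
      "\<And>x. x \<in> convex hull ?T \<Longrightarrow> w \<bullet> x > t"
      using separating_hyperplane_closed_point[of "convex hull ?T" y] by auto
    let ?m = "\<lambda>x. (- w) \<bullet> x + t"
    have m: "affine_functional ?m" unfolding affine_functional_def by blast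
    have my: "?m y > 0" using w by simp
    then obtain b where b: "b \<in> X" "?m b > 0"
      using affine_functional_nonpos_hull[OF m assms(3)] by force
    obtain s where s: "s \<ge> 0" "minorizes (\<lambda>x. l x + s * ?m x) X F"
      "\<exists>x\<in>X. ?m x > 0 \<and> l x + s * ?m x = F x"
      using minorant_push[OF assms(1) _ m b, of l F] l by (auto simp: Q_def)
    \<comment> \<open>The functional separating \<open>y\<close> is negative at all tight points, so the first new one costs
      a positive step.\<close>
    have "s \<noteq> 0"
    proof
      assume "s = 0"
      then obtain x where "x \<in> ?T" "?m x > 0" using s(3) by (auto simp: tight_points_def)
      moreover have "x \<in> convex hull ?T" using \<open>x \<in> ?T\<close> by (rule hull_inc)
      ultimately show False using w(2)[of x] by simp
    qed
    then have "l y + s * ?m y > l y" using s(1) my by simp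
    moreover obtain l' where l': "minorizes l' X F" "affine hull (tight_points F X l') = UNIV"
      "l' y \<ge> l y + s * ?m y"
      by (rule spanning_minorant[OF assms(1,2,3) s(2)])
    then have "l' \<in> Q" by (simp add: Q_def)
    ultimately show False using mx[of l'] l'(3) by linarith
  qed
  then show ?thesis using that[of l] l by (simp add: Q_def)
qed

section \<open>Regular subdivisions\<close>

text \<open>The points of \<open>S\<close> are those whose lifts \<open>(x, F x)\<close> lie in a lower face
  of the lifted configuration; the empty face counts.\<close>

definition lower_cell :: "('v::euclidean_space \<Rightarrow> real) \<Rightarrow> 'v set \<Rightarrow> 'v set \<Rightarrow> bool" where
  "lower_cell F X S \<longleftrightarrow> S \<subseteq> X \<and>
     (\<exists>l. affine_functional l \<and> (\<forall>x\<in>S. l x = F x) \<and> (\<forall>x\<in>X - S. l x < F x))"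

definition regular_subdivision :: "('v::euclidean_space \<Rightarrow> real) \<Rightarrow> 'v set \<Rightarrow> 'v set set" where
  "regular_subdivision F X = {convex hull S | S. lower_cell F X S}"

lemma lower_cellI:
  assumes "affine_functional l" "S \<subseteq> X" "\<And>x. x \<in> S \<Longrightarrow> l x = F x"
    "\<And>x. x \<in> X - S \<Longrightarrow> l x < F x"
  shows "lower_cell F X S"
  unfolding lower_cell_def using assms by blast

lemma lower_cellE:
  assumes "lower_cell F X S"
  obtains l where "affine_functional l" "S \<subseteq> X"
    "\<And>x. x \<in> S \<Longrightarrow> l x = F x"
    "\<And>x. x \<in> X - S \<Longrightarrow> l x < F x"
  using assms unfolding lower_cell_def by blast

lemma lower_cell_tight_points:
  assumes "minorizes l X F"
  shows "lower_cell F X (tight_points F X l)"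
  using assms unfolding minorizes_def tight_points_def
  by (intro lower_cellI[of l]) (auto simp: less_le)

lemma lower_cell_minorizes:
  assumes "lower_cell F X S"
  obtains l where "minorizes l X F" "tight_points F X l = S"
proof -
  obtain l where l: "affine_functional l" "S \<subseteq> X"
    "\<And>x. x \<in> S \<Longrightarrow> l x = F x"
    "\<And>x. x \<in> X - S \<Longrightarrow> l x < F x"
    using assms by (rule lower_cellE) blast
  then have "l x \<le> F x" if "x \<in> X" for x using that
    by (cases "x \<in> S") (auto simp: less_imp_le)
  moreover have "tight_points F X l = S" using l by (fastforce simp: tight_points_def)
  ultimately show ?thesis using that[of l] l(1) by (auto simp: minorizes_def)
qed

text \<open>A functional that exposes \<open>S\<close> in \<open>X\<close> dominates any interpolant of
  \<open>F\<close> on \<open>S\<close> once it is multiplied by a large constant, so exposed independent sets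
  are cells for every \<open>F\<close>.\<close>

lemma exposed_lower_cell:
  assumes "finite X" "S \<subseteq> X" "\<not> affine_dependent S" "affine_functional g"
    "\<And>x. x \<in> S \<Longrightarrow> g x = 0"
    "\<And>x. x \<in> X - S \<Longrightarrow> g x < 0"
  shows "lower_cell F X S"
proof -
  obtain m where m: "affine_functional m" "\<And>x. x \<in> S \<Longrightarrow> m x = F x"
    using affine_interpolation[OF assms(3), of F] by blast
  obtain e where e: "0 < e" "\<And>y. y \<in> X - S \<Longrightarrow> g y + e * (m y - F y) < 0"
    using small_perturbation[of "X - S" g "\<lambda>y. m y - F y"] assms(1,6) by auto
  show ?thesis
  proof (rule lower_cellI[of "\<lambda>x. m x + inverse e * g x"])
    show "affine_functional (\<lambda>x. m x + inverse e * g x)"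
      by (intro affine_functional_add affine_functional_scale m(1) assms(4))
    show "m x + inverse e * g x < F x" if "x \<in> X - S" for x
      using e(2)[OF that] e(1) by (simp add: field_simps)
    show "m x + inverse e * g x = F x" if "x \<in> S" for x
      using m(2)[OF that] assms(5)[OF that] by simp
  qed (fact assms(2))
qed

text \<open>A cell functional can be tilted slightly about any face of its simplex.\<close>

lemma lower_cell_subset:
  assumes "finite X" "lower_cell F X S" "\<not> affine_dependent S" "T \<subseteq> S"
  shows "lower_cell F X T"
proof -
  obtain l where l: "affine_functional l" "S \<subseteq> X"
    "\<And>x. x \<in> S \<Longrightarrow> l x = F x"
    "\<And>x. x \<in> X - S \<Longrightarrow> l x < F x"
    using assms(2) by (rule lower_cellE) blast
  obtain m where m: "affine_functional m"
    "\<And>x. x \<in> S \<Longrightarrow> m x = (if x \<in> T then 0 else -1)"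
    using affine_interpolation[OF assms(3), of "\<lambda>x. if x \<in> T then 0 else -1"] by blast
  have "l y - F y < 0" if "y \<in> X - S" for y using l(4)[OF that] by simp
  then obtain e where e: "0 < e"
    "\<And>y. y \<in> X - S \<Longrightarrow> (l y - F y) + e * m y < 0"
    using small_perturbation[of "X - S" "\<lambda>y. l y - F y" m] assms(1) by auto
  show ?thesis
  proof (rule lower_cellI[of "\<lambda>x. l x + e * m x"])
    show "affine_functional (\<lambda>x. l x + e * m x)"
      by (intro affine_functional_add affine_functional_scale l(1) m(1))
    show "l x + e * m x < F x" if "x \<in> X - T" for x
    proof (cases "x \<in> S")
      case True then show ?thesis using that m(2)[OF True] l(3)[OF True] e(1) by simp
    next
      case False then show ?thesis using e(2)[of x] that by simp
    qed
    show "l x + e * m x = F x" if "x \<in> T" for x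
      using that assms(4) l(3)[of x] m(2)[of x] by auto
  qed (use assms(4) l(2) in blast)
qed

text \<open>The difference \<open>d\<close> of the two cell functionals is nonnegative on \<open>S\<close>,
  nonpositive on \<open>T\<close>, and positive on \<open>S - T\<close>. A common point of the hulls has
  \<open>d = 0\<close>, so a convex combination of points of \<open>S\<close> that represents it has no weight
  outside \<open>T\<close>.\<close>

lemma convex_hull_lower_cells_Int:
  fixes X :: "'v::euclidean_space set"
  assumes "finite X" "lower_cell F X S" "lower_cell F X T"
  shows "convex hull S \<inter> convex hull T = convex hull (S \<inter> T)"
proof
  show "convex hull (S \<inter> T) \<subseteq> convex hull S \<inter> convex hull T"
    using hull_mono[of "S \<inter> T" S convex] hull_mono[of "S \<inter> T" T convex] by blast
  show "convex hull S \<inter> convex hull T \<subseteq> convex hull (S \<inter> T)"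
  proof
    fix y assume y: "y \<in> convex hull S \<inter> convex hull T"
    obtain l where l: "affine_functional l" "S \<subseteq> X"
      "\<And>x. x \<in> S \<Longrightarrow> l x = F x"
      "\<And>x. x \<in> X - S \<Longrightarrow> l x < F x"
      using assms(2) by (rule lower_cellE) blast
    obtain m where m: "affine_functional m" "T \<subseteq> X"
      "\<And>x. x \<in> T \<Longrightarrow> m x = F x"
      "\<And>x. x \<in> X - T \<Longrightarrow> m x < F x"
      using assms(3) by (rule lower_cellE) blast
    let ?d = "\<lambda>x. l x + (-1) * m x"
    have d: "affine_functional ?d" by (intro affine_functional_add affine_functional_scale l m)
    have dS: "?d x \<ge> 0" "x \<notin> T \<Longrightarrow> ?d x > 0" if "x \<in> S" for x
      using l(3)[OF that] l(2) that m(3)[of x] m(4)[of x] by (cases "x \<in> T"; force)+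
    have "?d x \<le> 0" if "x \<in> T" for x
      using m(3)[OF that] m(2) that l(3)[of x] l(4)[of x] by (cases "x \<in> S") force+
    then have dy: "?d y \<le> 0" using affine_functional_nonpos_hull[OF d, of y T] y by blast
    have fS: "finite S" using assms(1) l(2) by (rule rev_finite_subset)
    obtain u where u: "\<And>x. x \<in> S \<Longrightarrow> 0 \<le> u x" "sum u S = 1"
      "(\<Sum>x\<in>S. u x *\<^sub>R x) = y"
      using y by (auto simp: convex_hull_finite[OF fS])
    have "?d y = (\<Sum>x\<in>S. u x * ?d x)" using affine_functional_sum[OF d u(2)] u(3) by simp
    moreover have nn: "\<And>x. x \<in> S \<Longrightarrow> 0 \<le> u x * ?d x" using u(1) dS(1)
      by (metis mult_nonneg_nonneg)
    ultimately have "(\<Sum>x\<in>S. u x * ?d x) = 0"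
      using dy sum_nonneg[of S "\<lambda>x. u x * ?d x"] by simp
    then have "\<forall>x\<in>S. u x * ?d x = 0"
      using sum_nonneg_eq_0_iff[of S "\<lambda>x. u x * ?d x"] fS nn by blast
    then have z: "u x = 0" if "x \<in> S - T" for x using that dS(2)[of x] by auto
    have "sum u (S \<inter> T) = sum u S" by (rule sum.mono_neutral_left) (use fS z in auto)
    moreover have "(\<Sum>x\<in>S \<inter> T. u x *\<^sub>R x) = (\<Sum>x\<in>S. u x *\<^sub>R x)"
      by (rule sum.mono_neutral_left) (use fS z in auto)
    ultimately show "y \<in> convex hull (S \<inter> T)"
      using u fS by (subst convex_hull_finite) (auto intro!: exI[of _ u])
  qed
qed

theorem regular_subdivision_triangulation:
  fixes X :: "'v::euclidean_space set"
  assumes "finite X" "affine hull X = UNIV"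
    and indep: "\<And>S. lower_cell F X S \<Longrightarrow> \<not> affine_dependent S"
  shows "triangulation_of X (regular_subdivision F X)"
proof -
  have "finite {S. lower_cell F X S}"
    by (rule finite_subset[of _ "Pow X"]) (use assms(1) in \<open>auto simp: lower_cell_def\<close>)
  then have fin: "finite (regular_subdivision F X)" by (simp add: regular_subdivision_def)
  have "\<exists>n. n simplex C" if C: "C \<in> regular_subdivision F X" for C
  proof -
    obtain S where S: "C = convex hull S" "lower_cell F X S"
      using C unfolding regular_subdivision_def by blast
    then have "(int (card S) - 1) simplex C" using indep unfolding simplex_def by force
    then show ?thesis by blast
  qed
  moreover have "G \<in> regular_subdivision F X" if C: "C \<in> regular_subdivision F X"
    and G: "G face_of C" for G C
  proof -
    obtain S where S: "C = convex hull S" "lower_cell F X S"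
      using C unfolding regular_subdivision_def by blast
    then obtain T where "T \<subseteq> S" "G = convex hull T"
      using G face_of_convex_hull_affine_independent[OF indep] by blast
    then show ?thesis using lower_cell_subset[OF assms(1) S(2) indep[OF S(2)]]
      by (auto simp: regular_subdivision_def)
  qed
  moreover have "(C \<inter> D) face_of C" if CD: "C \<in> regular_subdivision F X"
    "D \<in> regular_subdivision F X" for C D
  proof -
    obtain S T where S: "C = convex hull S" "lower_cell F X S" and T: "D = convex hull T"
      "lower_cell F X T"
      using CD unfolding regular_subdivision_def by blast
    have "C \<inter> D = convex hull (S \<inter> T)"
      using convex_hull_lower_cells_Int[OF assms(1) S(2) T(2)] S T by simp
    then show ?thesis using face_of_convex_hull_affine_independent[OF indep[OF S(2)]] S(1) by blast
  qed
  ultimately have "simplicial_complex (regular_subdivision F X)"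
    unfolding simplicial_complex_def using fin by blast
  moreover have "vertices C \<subseteq> X" if C: "C \<in> regular_subdivision F X" for C
    using C extreme_point_of_convex_hull
    by (fastforce simp: regular_subdivision_def vertices_def lower_cell_def)
  moreover have "\<Union>(regular_subdivision F X) = convex hull X"
  proof
    show "\<Union>(regular_subdivision F X) \<subseteq> convex hull X"
      using hull_mono[of _ X convex] by (fastforce simp: regular_subdivision_def lower_cell_def)
    show "convex hull X \<subseteq> \<Union>(regular_subdivision F X)"
    proof
      fix y assume "y \<in> convex hull X"
      then obtain l where "minorizes l X F" "y \<in> convex hull (tight_points F X l)"
        using tight_hull_covers[OF assms(1,2)] by blast
      then show "y \<in> \<Union>(regular_subdivision F X)"
        using lower_cell_tight_points unfolding regular_subdivision_def by blast
    qed
  qed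
  ultimately show ?thesis by (auto simp: triangulation_of_def)
qed

section \<open>General position\<close>

lemma affine_independent_iff_spans:
  fixes S :: "'v::euclidean_space set"
  assumes "card S = DIM('v) + 1"
  shows "\<not> affine_dependent S \<longleftrightarrow> affine hull S = UNIV"
proof -
  have "finite S" using assms card.infinite by fastforce
  then show ?thesis
    using assms by (simp add: affine_independent_iff_card aff_dim_eq_full[symmetric])
qed

lemma general_position_independent:
  fixes A :: "'v::euclidean_space set"
  assumes "general_position A" "S \<subseteq> A" "card S = DIM('v) + 1"
  shows "\<not> affine_dependent S"
proof -
  have "affine hull S = UNIV"
  proof (rule ccontr)
    assume "affine hull S \<noteq> UNIV"
    then have "aff_dim S < DIM('v)"
      using aff_dim_eq_full[of S] aff_dim_le_DIM[of S] by linarith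
    then obtain w t where w: "w \<noteq> 0" "S \<subseteq> {x. w \<bullet> x = t}"
      by (rule aff_lowdim_subset_hyperplane)
    then show False using assms unfolding general_position_def hyperplane_def by blast
  qed
  then show ?thesis using affine_independent_iff_spans[OF assms(3)] by blast
qed

lemma general_position_independent_le:
  fixes A :: "'v::euclidean_space set"
  assumes "general_position A" "S \<subseteq> A" "finite A" "card A \<ge> DIM('v) + 1"
    "card S \<le> DIM('v) + 1"
  shows "\<not> affine_dependent S"
proof -
  obtain T where "S \<subseteq> T" "T \<subseteq> A" "card T = DIM('v) + 1"
    using exists_subset_between[OF assms(5,4,2,3)] by blast
  then show ?thesis
    using general_position_independent[OF assms(1)] affine_independent_subset by blast
qed

lemma general_positionI:
  fixes A :: "'v::euclidean_space set"
  assumes "\<And>S. S \<subseteq> A \<Longrightarrow> card S = DIM('v) + 1 \<Longrightarrow> \<not> affine_dependent S"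
  shows "general_position A"
  unfolding general_position_def hyperplane_def
proof (intro allI impI notI, elim exE conjE)
  fix S H u t assume *: "S \<subseteq> A" "card S = DIM('v) + 1" "S \<subseteq> H" "u \<noteq> 0"
    "H = {x. u \<bullet> x = t}"
  have "affine hull S \<subseteq> {x. u \<bullet> x = t}"
    using * by (intro hull_minimal affine_hyperplane) auto
  moreover have "affine hull S = UNIV" using assms affine_independent_iff_spans * by blast
  ultimately have e: "u \<bullet> x = t" for x by blast
  from e[of u] e[of 0] show False using * by simp
qed

lemma general_position_subset:
  fixes A :: "'v::euclidean_space set"
  assumes "general_position A" "B \<subseteq> A"
  shows "general_position B"
  unfolding general_position_def
proof (intro allI impI)
  fix S assume S: "S \<subseteq> B" "card S = DIM('v) + 1"
  have "S \<subseteq> A" using S(1) assms(2) by (rule order_trans)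
  then show "\<not> (\<exists>H. hyperplane H \<and> S \<subseteq> H)"
    using assms(1)[unfolded general_position_def] S(2) by simp
qed

lemma general_position_spans:
  fixes A :: "'v::euclidean_space set"
  assumes "general_position A" "card A \<ge> DIM('v) + 1"
  shows "affine hull A = UNIV"
proof -
  obtain T where "T \<subseteq> A" "card T = DIM('v) + 1"
    using obtain_subset_with_card_n[OF assms(2)] by blast
  then show ?thesis
    using general_position_independent[OF assms(1)] affine_independent_iff_spans[of T] hull_mono[of T A affine] by blast
qed

section \<open>Smooth and strictly convex bodies\<close>

text \<open>Two points where the same functional is maximal span a segment inside the boundary.\<close>

lemma strictly_convex_support_unique:
  assumes K: "strictly_convex_body K" and w: "w \<noteq> 0"
    "\<And>z. z \<in> K \<Longrightarrow> w \<bullet> z \<le> b"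
    and xy: "x \<in> K" "w \<bullet> x = b" "y \<in> K" "w \<bullet> y = b"
  shows "x = y"
proof (rule ccontr)
  assume "x \<noteq> y"
  have "convex K" using K by (auto simp: strictly_convex_body_def convex_body_def)
  moreover have "convex {z. w \<bullet> z = b}" by (rule convex_hyperplane)
  ultimately have "convex (K \<inter> {z. w \<bullet> z = b})" by (rule convex_Int)
  then have seg: "closed_segment x y \<subseteq> K \<inter> {z. w \<bullet> z = b}"
    using xy by (intro closed_segment_subset) auto
  have "interior K \<subseteq> interior {z. w \<bullet> z \<le> b}" using w(2)
    by (intro interior_mono) auto
  then have "interior K \<subseteq> {z. w \<bullet> z < b}" using w(1) by simp
  then have "closed_segment x y \<subseteq> frontier K"
    using seg closure_subset[of K] by (fastforce simp: frontier_def)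
  then show False using K \<open>x \<noteq> y\<close> unfolding strictly_convex_body_def by blast
qed

text \<open>A ray from \<open>c\<close> that misses the interior can be separated from it, which yields a
  supporting hyperplane at \<open>c\<close> with normal \<open>a\<close> and \<open>a \<bullet> v \<le>
  0\<close>. By smoothness it is the one with normal \<open>u\<close>, and comparing \<open>a\<close> and
  \<open>u\<close> on an interior point contradicts \<open>u \<bullet> v > 0\<close>.\<close>

lemma smooth_body_ray_meets_interior:
  assumes K: "smooth_body K" "c \<in> frontier K"
    and u: "\<And>x. x \<in> K \<Longrightarrow> u \<bullet> (x - c) \<ge> 0"
    and v: "u \<bullet> v > 0"
  shows "\<exists>s>0. c + s *\<^sub>R v \<in> interior K"
proof (rule ccontr)
  assume "\<not> ?thesis"
  then have no_hit: "c + s *\<^sub>R v \<notin> interior K" if "s > 0" for s using that by blast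
  have cvx: "convex K" "compact K" "interior K \<noteq> {}" using K
    by (auto simp: smooth_body_def convex_body_def)
  have cK: "c \<in> K" using K(2) cvx(2) by (auto simp: frontier_def compact_imp_closed)
  let ?R = "(\<lambda>s. c + s *\<^sub>R v) ` {0..}"
  have "?R = (\<lambda>x. c + x) ` ((\<lambda>s. s *\<^sub>R v) ` {0..})" by auto
  moreover have "linear (\<lambda>s. s *\<^sub>R v)" by (intro linearI) (auto simp: algebra_simps)
  ultimately have cR: "convex ?R"
    by (metis convex_translation convex_linear_image convex_real_interval(1))
  have "c + s *\<^sub>R v \<notin> interior K" if "s \<ge> 0" for s
    using no_hit[of s] that K(2) by (cases "s = 0") (auto simp: frontier_def)
  then have "?R \<inter> interior K = {}" by auto
  then obtain a b where a: "a \<noteq> 0"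
    "\<And>x. x \<in> ?R \<Longrightarrow> a \<bullet> x \<le> b"
    "\<And>x. x \<in> interior K \<Longrightarrow> a \<bullet> x \<ge> b"
    using separating_hyperplane_sets[OF cR convex_interior[OF cvx(1)] _ cvx(3)] by blast
  have "closure (interior K) \<subseteq> {x. a \<bullet> x \<ge> b}"
    using a(3) by (intro closure_minimal closed_halfspace_ge) auto
  then have aK: "a \<bullet> x \<ge> b" if "x \<in> K" for x
    using that convex_closure_interior[OF cvx(1,3)] closure_subset by blast
  have "c \<in> ?R" by (intro image_eqI[of _ _ 0]) auto
  then have ac: "a \<bullet> c = b" using aK[OF cK] a(2) by force
  have "c + v \<in> ?R" by (intro image_eqI[of _ _ 1]) auto
  then have av: "a \<bullet> v \<le> 0" using a(2)[of "c + v"] ac by (simp add: inner_add_right)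
  have "u \<noteq> 0" using v by auto
  have "supporting_hyperplane K c {y. (- a) \<bullet> y = - b}"
    unfolding supporting_hyperplane_def
    by (intro exI[of _ "- a"] exI[of _ "- b"]) (use a(1) ac aK in auto)
  moreover have "supporting_hyperplane K c {y. (- u) \<bullet> y = - (u \<bullet> c)}"
    unfolding supporting_hyperplane_def
    by (intro exI[of _ "- u"] exI[of _ "- (u \<bullet> c)"]) (use \<open>u \<noteq> 0\<close> u in \<open>auto simp: inner_diff_right\<close>)
  ultimately have eq: "{y. (- a) \<bullet> y = - b} = {y. (- u) \<bullet> y = - (u \<bullet> c)}"
    using K unfolding smooth_body_def by blast
  have par: "a \<bullet> z = 0 \<longleftrightarrow> u \<bullet> z = 0" for z
  proof -
    have "c + z \<in> {y. (- a) \<bullet> y = - b} \<longleftrightarrow> c + z \<in> {y. (- u) \<bullet> y = - (u \<bullet> c)}" using eq by simp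
    then show ?thesis using ac by (simp add: inner_add_right)
  qed
  obtain x where x: "x \<in> interior K" using cvx by blast
  \<comment> \<open>A combination of \<open>x - c\<close> and \<open>v\<close> parallel to the supporting hyperplane.\<close>
  let ?z = "(u \<bullet> v) *\<^sub>R (x - c) - (u \<bullet> (x - c)) *\<^sub>R v"
  have "u \<bullet> ?z = 0" by (simp add: inner_diff_right)
  then have "a \<bullet> ?z = 0" using par by blast
  then have e: "(u \<bullet> v) * (a \<bullet> (x - c)) = (u \<bullet> (x - c)) * (a \<bullet> v)"
    by (simp add: inner_diff_right)
  have xK: "x \<in> K" using x interior_subset by blast
  have "(u \<bullet> (x - c)) * (a \<bullet> v) \<le> 0" using u[OF xK] av
    by (simp add: mult_nonneg_nonpos)
  moreover have ax: "a \<bullet> (x - c) \<ge> 0" using aK[OF xK] ac by (simp add: inner_diff_right)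
  ultimately have "a \<bullet> (x - c) = 0" using e v
    by (metis linorder_not_less mult_pos_pos order_antisym_conv)
  moreover have "interior K \<subseteq> interior {z. a \<bullet> z \<ge> b}" using aK
    by (intro interior_mono) auto
  then have "a \<bullet> x > b" using x a(1) by auto
  ultimately show False using ac by (simp add: inner_diff_right)
qed

section \<open>Stereographic projection as a projective change of coordinates\<close>

text \<open>The vector \<open>u\<close> is the inner normal of \<open>K\<close> at \<open>c\<close>, and
  \<open>\<tau>\<close> is the signed height, measured by \<open>u\<close>, of the chart hyperplane above
  \<open>c\<close>; a negative \<open>\<tau>\<close> means that the hyperplane lies on the side of
  \<open>c\<close> away from \<open>K\<close>.\<close>

locale stereographic_coordinates =
  fixes K :: "'e::euclidean_space set"
    and c :: 'e and \<phi> :: "'m::euclidean_space \<Rightarrow> 'e"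
    and p :: 'e and L :: "'m \<Rightarrow> 'e" and u :: 'e and \<tau> :: real
  assumes smooth: "smooth_body K" and strict: "strictly_convex_body K"
    and center: "c \<in> frontier K"
    and chart: "\<phi> = (\<lambda>y. p + L y)" "linear L" "inj L"
    and range_chart: "range \<phi> = {z. u \<bullet> (z - c) = \<tau>}"
      and \<tau>: "\<tau> \<noteq> 0"
    and height_pos: "\<And>x. x \<in> K \<Longrightarrow> x \<noteq> c \<Longrightarrow> u \<bullet> (x - c) > 0"
begin

lemma K_convex: "convex K" and K_closed: "closed K" and K_compact: "compact K"
 
  using smooth by (auto simp: smooth_body_def convex_body_def compact_imp_closed)

lemma c_in_K: "c \<in> K"
  using center K_closed by (auto simp: frontier_def)

text \<open>The vector on the projection ray of \<open>y\<close> normalized to height \<open>1\<close>; it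
  points into \<open>K\<close> for either sign of \<open>\<tau>\<close>.\<close>

definition dir :: "'m \<Rightarrow> 'e" where "dir y = (1 / \<tau>) *\<^sub>R (\<phi> y - c)"

lemma chart_eq: "\<phi> y = p + L y"
  using chart(1) by simp

lemma chart_dir: "\<phi> y = c + \<tau> *\<^sub>R dir y"
  using \<tau> by (simp add: dir_def)

lemma height_dir [simp]: "u \<bullet> dir y = 1"
proof -
  have "u \<bullet> (\<phi> y - c) = \<tau>" using range_chart by blast
  then show ?thesis using \<tau> by (simp add: dir_def)
qed

lemma dir_nonzero: "dir y \<noteq> 0" using height_dir[of y] by fastforce

lemma dir_affine: "dir y = dir 0 + (1 / \<tau>) *\<^sub>R L y"
  using chart(2) by (simp add: dir_def chart_eq linear_0 algebra_simps)

lemma inj_dir: "dir y = dir z \<Longrightarrow> y = z"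
  using chart(3) \<tau> by (auto simp: dir_def chart_eq inj_eq)

lemma ex_dir:
  assumes "u \<bullet> z = 1"
  obtains y where "z = dir y"
proof -
  have "c + \<tau> *\<^sub>R z \<in> range \<phi>" using assms by (simp add: range_chart)
  then obtain y where "\<phi> y = c + \<tau> *\<^sub>R z" by auto
  then show ?thesis using that[of y] \<tau> by (simp add: dir_def)
qed

lemma stereo_ray:
  assumes "r \<noteq> 0"
  shows "stereo c \<phi> (c + r *\<^sub>R dir y) = y"
  unfolding stereo_def
proof (rule the_equality)
  have "\<phi> y = (1 - \<tau> / r) *\<^sub>R c + (\<tau> / r) *\<^sub>R (c + r *\<^sub>R dir y)"
    using assms by (simp add: chart_dir algebra_simps)
  then show "\<phi> y \<in> affine hull {c, c + r *\<^sub>R dir y}"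
    unfolding affine_hull_2
      by (intro CollectI exI[of _ "1 - \<tau> / r"] exI[of _ "\<tau> / r"]) auto
next
  fix z assume "\<phi> z \<in> affine hull {c, c + r *\<^sub>R dir y}"
  then obtain a b where ab: "\<phi> z = a *\<^sub>R c + b *\<^sub>R (c + r *\<^sub>R dir y)"
    "a + b = 1"
    unfolding affine_hull_2 by blast
  have "a = 1 - b" using ab(2) by simp
  with ab(1) have e: "\<tau> *\<^sub>R dir z = (b * r) *\<^sub>R dir y"
    by (simp add: chart_dir algebra_simps)
  then have "u \<bullet> (\<tau> *\<^sub>R dir z) = u \<bullet> ((b * r) *\<^sub>R dir y)" by simp
  then have "\<tau> = b * r" by simp
  then show "z = y" using e \<tau> inj_dir[of z y] by simp
qed

lemma ray_point:
  assumes "x \<in> K" "x \<noteq> c"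
  obtains y r where "r > 0" "x = c + r *\<^sub>R dir y"
proof -
  let ?r = "u \<bullet> (x - c)"
  have r: "?r > 0" using height_pos assms by blast
  then obtain y where "(1 / ?r) *\<^sub>R (x - c) = dir y"
    using ex_dir[of "(1 / ?r) *\<^sub>R (x - c)"] by auto
  then have "?r *\<^sub>R dir y = x - c" using r
    by (metis inverse_eq_divide less_irrefl scaleR_one scaleR_scaleR right_inverse)
  then show ?thesis using that[of ?r y] r by simp
qed

lemma ray_ne_center: "r > 0 \<Longrightarrow> c + r *\<^sub>R dir y \<noteq> c"
  using dir_nonzero by simp

text \<open>Smoothness provides a point of the ray in the interior of \<open>K\<close>. From it the ray runs
  through the interior until it leaves \<open>K\<close>, and convexity gives the same on the way back to
  \<open>c\<close>.\<close>

lemma radius_exists: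
  "\<exists>s>0. \<forall>r>0. (c + r *\<^sub>R dir y \<in> K \<longleftrightarrow> r \<le> s) \<and> (c + r *\<^sub>R dir y \<in> frontier K \<longleftrightarrow> r = s)"
proof -
  have "u \<bullet> (x - c) \<ge> 0" if "x \<in> K" for x using height_pos[OF that]
    by (cases "x = c") auto
  then obtain s0 where s0: "s0 > 0" "c + s0 *\<^sub>R dir y \<in> interior K"
    using smooth_body_ray_meets_interior[OF smooth center, of u "dir y"] by auto
  obtain d where d: "d > 0" "(c + s0 *\<^sub>R dir y) + d *\<^sub>R dir y \<in> frontier K"
    using ray_to_frontier[OF compact_imp_bounded[OF K_compact] s0(2) dir_nonzero] by blast
  define s where "s = s0 + d"
  have s: "s > 0" "c + s *\<^sub>R dir y \<in> frontier K" using s0 d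
    by (auto simp: s_def algebra_simps)
  have fK: "x \<in> K" "x \<notin> interior K" if "x \<in> frontier K" for x
    using that K_closed by (auto simp: frontier_def)
  have mid: "c + r *\<^sub>R dir y \<in> open_segment (c + r1 *\<^sub>R dir y) (c + r2 *\<^sub>R dir y)"
    if "r1 < r" "r < r2" for r r1 r2
  proof -
    let ?a = "(r - r1) / (r2 - r1)"
    have "(1 - ?a) * r1 + ?a * r2 = r1 + ?a * (r2 - r1)" by algebra
    also have "\<dots> = r" using that by simp
    finally have "(1 - ?a) *\<^sub>R (c + r1 *\<^sub>R dir y) + ?a *\<^sub>R (c + r2 *\<^sub>R dir y) = c + r *\<^sub>R dir y"
      by (simp add: algebra_simps flip: scaleR_add_left)
    then show ?thesis unfolding in_segment using that dir_nonzero
      by (intro conjI exI[of _ ?a]) (auto simp: field_simps)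
  qed
  have inner: "c + r *\<^sub>R dir y \<in> interior K" if r: "0 < r" "r < s" for r
  proof -
    have cl: "c \<in> closure K" "c + s *\<^sub>R dir y \<in> closure K"
      using c_in_K fK(1)[OF s(2)] closure_subset by blast+
    consider "r < s0" | "r = s0" | "s0 < r" by linarith
    then show ?thesis
    proof cases
      case 1
      have "open_segment (c + s0 *\<^sub>R dir y) c \<subseteq> interior K"
        by (rule in_interior_closure_convex_segment[OF K_convex s0(2) cl(1)])
      then show ?thesis using mid[of 0 r s0] 1 r by (auto simp: open_segment_commute)
    next
      case 2 then show ?thesis using s0 by simp
    next
      case 3
      have "open_segment (c + s0 *\<^sub>R dir y) (c + s *\<^sub>R dir y) \<subseteq> interior K"
        by (rule in_interior_closure_convex_segment[OF K_convex s0(2) cl(2)])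
      then show ?thesis using mid[of s0 r s] 3 r by auto
    qed
  qed
  have outer: "c + r *\<^sub>R dir y \<notin> K" if "r > s" for r
  proof
    assume "c + r *\<^sub>R dir y \<in> K"
    then have "c + r *\<^sub>R dir y \<in> closure K" using closure_subset by blast
    then have "open_segment (c + s0 *\<^sub>R dir y) (c + r *\<^sub>R dir y) \<subseteq> interior K"
      by (rule in_interior_closure_convex_segment[OF K_convex s0(2)])
    moreover have "s0 < s" using d(1) by (simp add: s_def)
    ultimately show False using mid[of s0 s r] that fK(2)[OF s(2)] by blast
  qed
  show ?thesis
  proof (intro exI[of _ s] conjI allI impI s(1))
    fix r :: real assume r: "r > 0"
    show "c + r *\<^sub>R dir y \<in> K \<longleftrightarrow> r \<le> s"
      using outer[of r] inner[of r] r fK(1)[OF s(2)] interior_subset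
        by (cases r s rule: linorder_cases) auto
    show "c + r *\<^sub>R dir y \<in> frontier K \<longleftrightarrow> r = s"
      using outer[of r] inner[of r] r fK s(2) by (cases r s rule: linorder_cases) auto
  qed
qed

definition radius :: "'m \<Rightarrow> real" where
  "radius y = (SOME s. s > 0 \<and> (\<forall>r>0. (c + r *\<^sub>R dir y \<in> K \<longleftrightarrow> r \<le> s) \<and>
     (c + r *\<^sub>R dir y \<in> frontier K \<longleftrightarrow> r = s)))"

text \<open>In the projective coordinates \<open>(y, 1 / r)\<close> of the point \<open>c + r *\<^sub>R dir
  y\<close>, the center goes to infinity, the rays from \<open>c\<close> become vertical lines, and
  \<open>K\<close> becomes the epigraph of this function.\<close>

definition boundary_height :: "'m \<Rightarrow> real" where "boundary_height y = 1 / radius y"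

lemma radius_pos: "radius y > 0"
  and ray_in_K: "r > 0 \<Longrightarrow> c + r *\<^sub>R dir y \<in> K \<longleftrightarrow> r \<le> radius y"
  and ray_in_frontier: "r > 0 \<Longrightarrow> c + r *\<^sub>R dir y \<in> frontier K \<longleftrightarrow> r = radius y"
  using someI_ex[OF radius_exists[of y]] unfolding radius_def by blast+

lemma boundary_height_pos: "boundary_height y > 0" using radius_pos by (simp add: boundary_height_def)

text \<open>In the same coordinates, \<open>H\<close> is the graph of the affine functional
  \<open>l\<close>.\<close>

definition graph_hyperplane :: "'e set \<Rightarrow> ('m \<Rightarrow> real) \<Rightarrow> bool" where
  "graph_hyperplane H l \<longleftrightarrow> c \<notin> H \<and> affine_functional l \<and> (\<forall>y. \<forall>r>0. c + r *\<^sub>R dir y \<in> H \<longleftrightarrow> r * l y = 1)"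

lemma K_ball_iff:
  assumes "graph_hyperplane H l"
  shows "y \<in> K_ball K c \<phi> H \<longleftrightarrow> boundary_height y \<le> l y"
proof
  assume "y \<in> K_ball K c \<phi> H"
  then obtain x where x: "x \<in> H" "x \<in> K" "y = stereo c \<phi> x" by (auto simp: K_ball_def)
  have "x \<noteq> c" using x assms by (auto simp: graph_hyperplane_def)
  then obtain z r where r: "r > 0" "x = c + r *\<^sub>R dir z" using ray_point x(2) by blast
  have zy: "z = y" using x(3) r stereo_ray by simp
  have "r \<le> radius y" "r * l y = 1" using x(1,2) r zy assms ray_in_K[of r y]
    by (simp_all add: graph_hyperplane_def)
  then have "l y = 1 / r" using r(1) by (simp add: field_simps)
  then show "boundary_height y \<le> l y" using r(1) \<open>r \<le> radius y\<close> by (simp add: boundary_height_def frac_le)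
next
  assume le: "boundary_height y \<le> l y"
  then have l: "l y > 0" using boundary_height_pos[of y] by linarith
  have "1 / l y \<le> radius y" using le l radius_pos[of y] by (simp add: boundary_height_def field_simps)
  then have "c + (1 / l y) *\<^sub>R dir y \<in> H \<inter> K"
    using l assms ray_in_K[of "1 / l y"] by (auto simp: graph_hyperplane_def)
  then show "y \<in> K_ball K c \<phi> H"
    unfolding K_ball_def using stereo_ray[of "1 / l y" y] l
      by (intro image_eqI[of _ _ "c + (1 / l y) *\<^sub>R dir y"]) auto
qed

lemma K_sphere_iff:
  assumes "graph_hyperplane H l"
  shows "y \<in> K_sphere K c \<phi> H \<longleftrightarrow> l y = boundary_height y"
proof
  assume "y \<in> K_sphere K c \<phi> H"
  then obtain x where x: "x \<in> H" "x \<in> frontier K" "y = stereo c \<phi> x"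
    by (auto simp: K_sphere_def)
  have "x \<noteq> c" "x \<in> K" using x assms K_closed
    by (auto simp: graph_hyperplane_def frontier_def)
  then obtain z r where r: "r > 0" "x = c + r *\<^sub>R dir z" using ray_point by blast
  have zy: "z = y" using x(3) r stereo_ray by simp
  have "r = radius y" "r * l y = 1" using x(1,2) r zy assms ray_in_frontier[of r y]
    by (simp_all add: graph_hyperplane_def)
  then show "l y = boundary_height y" using r(1) by (simp add: boundary_height_def field_simps)
next
  assume le: "l y = boundary_height y"
  then have "radius y * l y = 1" using radius_pos[of y] by (simp add: boundary_height_def)
  then have "c + radius y *\<^sub>R dir y \<in> H \<inter> frontier K"
    using radius_pos[of y] assms ray_in_frontier[of "radius y"] by (auto simp: graph_hyperplane_def)
  then show "y \<in> K_sphere K c \<phi> H"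
    unfolding K_sphere_def using stereo_ray[of "radius y" y] radius_pos[of y]
    by (intro image_eqI[of _ _ "c + radius y *\<^sub>R dir y"]) auto
qed

lemma hyperplane_is_graph:
  assumes "hyperplane H" "c \<notin> H"
  obtains l where "graph_hyperplane H l"
proof -
  obtain w b where w: "H = {x. w \<bullet> x = b}" using assms by (auto simp: hyperplane_def)
  let ?d = "b - w \<bullet> c"
  have d: "?d \<noteq> 0" using assms w by auto
  let ?l = "\<lambda>y. w \<bullet> dir y / ?d"
  have eq: "?l = (\<lambda>y. (1 / (\<tau> * ?d)) * (w \<bullet> L y) + w \<bullet> dir 0 / ?d)"
  proof
    show "?l y = (1 / (\<tau> * ?d)) * (w \<bullet> L y) + w \<bullet> dir 0 / ?d" for y
      unfolding dir_affine[of y] by (simp add: inner_add_right add_divide_distrib)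
  qed
  have "linear (\<lambda>y. w \<bullet> L y)"
    using linear_compose[OF chart(2) bounded_linear.linear[OF bounded_linear_inner_right[of w]]]
    by (simp add: o_def)
  then have "affine_functional (\<lambda>y. w \<bullet> L y)" by (rule affine_functional_linear)
  then have "affine_functional (\<lambda>y. (1 / (\<tau> * ?d)) * (w \<bullet> L y) + w \<bullet> dir 0 / ?d)"
    by (intro affine_functional_add affine_functional_scale affine_functional_const)
  then have "affine_functional ?l" by (subst eq)
  moreover have "c + r *\<^sub>R dir y \<in> H \<longleftrightarrow> r * ?l y = 1" for y r
    using d by (auto simp: w inner_add_right field_simps)
  ultimately show ?thesis using that[of ?l] assms(2) by (auto simp: graph_hyperplane_def)
qed

text \<open>The vectors \<open>dir y\<close> fill the hyperplane \<open>u \<bullet> z = 1\<close>, which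
  avoids the origin, so every affine functional \<open>l\<close> on it is the restriction of a linear
  functional \<open>?W\<close>; this becomes the normal of \<open>H\<close>.\<close>

lemma graph_is_hyperplane:
  assumes "affine_functional l" "boundary_height y0 \<le> l y0"
  obtains H where "cutting_hyperplane K c H" "graph_hyperplane H l"
proof -
  obtain v b where l: "l = (\<lambda>y. v \<bullet> y + b)" using assms
    by (auto simp: affine_functional_def)
  obtain g where g: "linear g" "g \<circ> L = id"
    using linear_injective_left_inverse[OF chart(2,3)] by blast
  have gL: "g (L y) = y" for y using g(2) by (metis comp_apply id_apply)
  \<comment> \<open>Along \<open>dir 0\<close> the functional has the value \<open>b\<close>, and on the directions of the chart, where
    \<open>dir y - dir 0\<close> is \<open>L y\<close> divided by \<open>\<tau>\<close>, it has gradient \<open>v\<close>.\<close>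
  let ?W = "\<lambda>z. (u \<bullet> z) * b + \<tau> * (v \<bullet> g (z - (u \<bullet> z) *\<^sub>R dir 0))"
  have "linear ?W"
    by (intro linearI)
      (simp_all add: linear_add[OF g(1)] linear_diff[OF g(1)] linear_cmul[OF g(1)] inner_add_right inner_diff_right algebra_simps)
  then have "affine_functional ?W" by (rule affine_functional_linear)
  then obtain w k where W: "?W = (\<lambda>x. w \<bullet> x + k)"
    unfolding affine_functional_def by blast
  have w: "?W z = w \<bullet> z + k" for z by (rule fun_cong[OF W])
  have "k = 0" using w[of 0] linear_0[OF g(1)] by simp
  have wd: "w \<bullet> dir y = l y" for y
  proof -
    have "dir y - (u \<bullet> dir y) *\<^sub>R dir 0 = (1 / \<tau>) *\<^sub>R L y"
      using dir_affine[of y] height_dir[of y] by (metis add_diff_cancel_left' scaleR_one)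
    then have "?W (dir y) = l y"
      using \<tau> gL by (simp add: l linear_cmul[OF g(1)])
    then show ?thesis unfolding w using \<open>k = 0\<close> by simp
  qed
  have l0: "l y0 > 0" using assms(2) boundary_height_pos[of y0] by linarith
  define H where "H = {x. w \<bullet> x = 1 + w \<bullet> c}"
  have gr: "graph_hyperplane H l"
    using assms(1) by (auto simp: graph_hyperplane_def H_def inner_add_right wd)
  have "y0 \<in> K_ball K c \<phi> H" using K_ball_iff[OF gr] assms(2) by blast
  then have "H \<inter> K \<noteq> {}" by (auto simp: K_ball_def)
  moreover have "w \<noteq> 0" using wd[of y0] l0 by auto
  ultimately have "cutting_hyperplane K c H"
    using gr unfolding cutting_hyperplane_def hyperplane_def graph_hyperplane_def H_def by blast
  then show ?thesis using that gr by blast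
qed

lemma stereo_inv_eq: "stereo_inv K c \<phi> y = c + radius y *\<^sub>R dir y"
  unfolding stereo_inv_def
proof (rule inv_into_f_eq)
  show "inj_on (stereo c \<phi>) (frontier K - {c})"
  proof (rule inj_onI)
    fix x x' assume x: "x \<in> frontier K - {c}" "x' \<in> frontier K - {c}"
      "stereo c \<phi> x = stereo c \<phi> x'"
    have "x \<in> K" "x' \<in> K" using x K_closed by (auto simp: frontier_def)
    then obtain y r y' r' where r: "r > 0" "x = c + r *\<^sub>R dir y" "r' > 0"
      "x' = c + r' *\<^sub>R dir y'"
      using ray_point x by (metis Diff_iff singletonI)
    then have "y = y'" using x(3) stereo_ray by simp
    moreover have "r = radius y" "r' = radius y'" using x r ray_in_frontier by auto
    ultimately show "x = x'" using r by simp
  qed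
  show "c + radius y *\<^sub>R dir y \<in> frontier K - {c}"
    using ray_in_frontier[OF radius_pos] ray_ne_center[OF radius_pos] by simp
  show "stereo c \<phi> (c + radius y *\<^sub>R dir y) = y" using stereo_ray radius_pos[of y]
    by simp
qed

lemma dir_sum:
  assumes "sum a B = 1"
  shows "dir (\<Sum>b\<in>B. a b *\<^sub>R b) = (\<Sum>b\<in>B. a b *\<^sub>R dir b)"
proof -
  have "(\<Sum>b\<in>B. a b *\<^sub>R dir b) = (\<Sum>b\<in>B. a b *\<^sub>R dir 0 + (1 / \<tau>) *\<^sub>R (a b *\<^sub>R L b))"
    by (intro sum.cong refl) (subst dir_affine, simp add: algebra_simps)
  also have "\<dots> = (\<Sum>b\<in>B. a b) *\<^sub>R dir 0 + (1 / \<tau>) *\<^sub>R (\<Sum>b\<in>B. a b *\<^sub>R L b)"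
    by (simp add: sum.distrib scaleR_sum_left scaleR_sum_right)
  also have "(\<Sum>b\<in>B. a b *\<^sub>R L b) = L (\<Sum>b\<in>B. a b *\<^sub>R b)"
    by (simp add: linear_sum[OF chart(2)] linear_cmul[OF chart(2)])
  finally show ?thesis using assms by (subst dir_affine) simp
qed

text \<open>A projective map preserves collinearity but not affine coordinates: if \<open>y\<close> has
  coordinates \<open>a b\<close> with respect to \<open>B\<close>, then the point above \<open>y\<close> on
  the graph of \<open>l\<close> has the reweighted coordinates \<open>a b * l b / l y\<close> with respect to
  the preimages of \<open>B\<close> on the boundary of \<open>K\<close>.\<close>

lemma below_in_circumball:
  assumes "finite B" "affine hull B = UNIV" "affine_functional l"
    "\<And>b. b \<in> B \<Longrightarrow> l b = boundary_height b" "boundary_height y \<le> l y"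
  shows "y \<in> K_circumball K c \<phi> B"
proof -
  have l: "l y > 0" using assms(5) boundary_height_pos[of y] by linarith
  have "y \<in> affine hull B" using assms(2) by simp
  then obtain a where a: "sum a B = 1" "(\<Sum>b\<in>B. a b *\<^sub>R b) = y"
    unfolding affine_hull_finite[OF assms(1)] by blast
  let ?s = "stereo_inv K c \<phi>"
  let ?a = "\<lambda>x. a (stereo c \<phi> x) * l (stereo c \<phi> x) / l y"
  have st: "stereo c \<phi> (?s b) = b" for b using stereo_inv_eq stereo_ray radius_pos[of b]
    by simp
  have inj: "inj_on ?s B" by (metis inj_onI st)
  have "(\<Sum>b\<in>B. a b * l b) = l y" using affine_functional_sum[OF assms(3) a(1)] a(2) by simp
  then have one: "(\<Sum>b\<in>B. a b * l b / l y) = 1"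
    using l unfolding sum_divide_distrib[symmetric] by simp
  then have "sum ?a (?s ` B) = 1" by (simp add: sum.reindex[OF inj] st)
  moreover have "(\<Sum>x\<in>?s ` B. ?a x *\<^sub>R x) = c + (1 / l y) *\<^sub>R dir y"
  proof -
    have "(\<Sum>x\<in>?s ` B. ?a x *\<^sub>R x) = (\<Sum>b\<in>B. (a b * l b / l y) *\<^sub>R ?s b)"
      by (simp add: sum.reindex[OF inj] st)
    also have "\<dots> = (\<Sum>b\<in>B. (a b * l b / l y) *\<^sub>R c + (1 / l y) *\<^sub>R (a b *\<^sub>R dir b))"
    proof (rule sum.cong[OF refl])
      fix b assume "b \<in> B"
      then have "l b * radius b = 1" using assms(4) radius_pos[of b] by (simp add: boundary_height_def)
      then have "(a b * l b / l y) * radius b = (1 / l y) * a b" by simp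
      then show "(a b * l b / l y) *\<^sub>R ?s b = (a b * l b / l y) *\<^sub>R c + (1 / l y) *\<^sub>R (a b *\<^sub>R dir b)"
        by (simp add: stereo_inv_eq scaleR_add_right)
    qed
    also have "\<dots> = (\<Sum>b\<in>B. a b * l b / l y) *\<^sub>R c + (1 / l y) *\<^sub>R dir y"
      using dir_sum[OF a(1)] a(2) by (simp add: sum.distrib scaleR_sum_left scaleR_sum_right)
    finally show ?thesis using one by simp
  qed
  ultimately have "c + (1 / l y) *\<^sub>R dir y \<in> affine hull (?s ` B)"
    using affine_hull_finite[of "?s ` B"] assms(1) by blast
  moreover have "c + (1 / l y) *\<^sub>R dir y \<in> K"
    using ray_in_K[of "1 / l y" y] l assms(5) radius_pos[of y] by (simp add: boundary_height_def field_simps)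
  ultimately show ?thesis unfolding K_circumball_def K_ball_def
    using stereo_ray[of "1 / l y" y] l
      by (intro image_eqI[of _ _ "c + (1 / l y) *\<^sub>R dir y"]) auto
qed

text \<open>This is what makes the empty simplex a cell.  By strict convexity a tangent hyperplane has a
  one-point ball, which can be placed off the finite set.\<close>

lemma ex_avoiding_ball:
  assumes "finite X"
  obtains H where "cutting_hyperplane K c H" "X \<inter> K_ball K c \<phi> H = {}"
proof -
  have "X \<noteq> UNIV" using finite_imp_bounded[OF assms] not_bounded_UNIV by auto
  then obtain y where y: "y \<notin> X" by blast
  define q where "q = c + radius y *\<^sub>R dir y"
  have q: "q \<in> frontier K" "q \<noteq> c" "q \<in> K"
    unfolding q_def using ray_in_frontier[OF radius_pos, of y] ray_ne_center[OF radius_pos, of y]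
      ray_in_K[OF radius_pos, of y] by simp_all
  then obtain H where "supporting_hyperplane K q H" using smooth unfolding smooth_body_def by blast
  then obtain w b where w: "w \<noteq> 0" "H = {x. w \<bullet> x = b}" "q \<in> H"
    "\<And>x. x \<in> K \<Longrightarrow> w \<bullet> x \<le> b"
    unfolding supporting_hyperplane_def by blast
  have "x = q" if "x \<in> H" "x \<in> K" for x
    by (rule strictly_convex_support_unique[OF strict w(1) w(4)]) (use that w(2,3) q(3) in simp_all)
  then have HK: "H \<inter> K = {q}" using w(3) q(3) by blast
  have "hyperplane H" unfolding hyperplane_def using w(1,2) by (intro exI[of _ w] exI[of _ b]) simp
  moreover have "c \<notin> H" using HK c_in_K q(2) by (metis IntI singletonD)
  ultimately have "cutting_hyperplane K c H" using HK by (simp add: cutting_hyperplane_def)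
  moreover have "K_ball K c \<phi> H = {y}"
    using stereo_ray[of "radius y" y] radius_pos[of y] by (simp add: K_ball_def HK q_def)
  ultimately show ?thesis using that[of H] y by simp
qed

text \<open>A \<open>K\<close>-sphere is the set where the functional of its hyperplane agrees with
  \<open>boundary_height\<close>, and the outside of the \<open>K\<close>-ball is the set where it is strictly
  smaller. For the empty cell a functional far below would do on the right, but the hyperplane has to meet
  \<open>K\<close>.\<close>

theorem K_Delaunay_eq_regular_subdivision:
  assumes "finite X"
  shows "K_Delaunay K c \<phi> X = regular_subdivision boundary_height X"
proof -
  have "(\<exists>H. cutting_hyperplane K c H \<and> S \<subseteq> K_sphere K c \<phi> H \<and> (\<forall>x\<in>X - S. x \<notin> K_ball K c \<phi> H))
    \<longleftrightarrow> lower_cell boundary_height X S" (is "?D \<longleftrightarrow> _") if S: "S \<subseteq> X" for S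
  proof
    assume ?D
    then obtain H where H: "cutting_hyperplane K c H" "S \<subseteq> K_sphere K c \<phi> H"
      "\<forall>x\<in>X - S. x \<notin> K_ball K c \<phi> H"
      by blast
    then obtain l where l: "graph_hyperplane H l"
      using hyperplane_is_graph unfolding cutting_hyperplane_def by blast
    show "lower_cell boundary_height X S"
    proof (rule lower_cellI[of l])
      show "affine_functional l" using l by (simp add: graph_hyperplane_def)
      show "l x = boundary_height x" if "x \<in> S" for x using H(2) K_sphere_iff[OF l] that by blast
      show "l x < boundary_height x" if "x \<in> X - S" for x using H(3) K_ball_iff[OF l, of x] that by simp
    qed (fact S)
  next
    assume "lower_cell boundary_height X S"
    then obtain l where l: "affine_functional l" "\<forall>x\<in>S. l x = boundary_height x"
      "\<forall>x\<in>X - S. l x < boundary_height x"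
      unfolding lower_cell_def by blast
    show ?D
    proof (cases "S = {}")
      case True
      obtain H where "cutting_hyperplane K c H" "X \<inter> K_ball K c \<phi> H = {}"
        using ex_avoiding_ball[OF assms] .
      then show ?thesis using True by (intro exI[of _ H]) auto
    next
      case False
      then obtain y0 where "y0 \<in> S" by blast
      then have "boundary_height y0 \<le> l y0" using l(2) by simp
      then obtain H where H: "cutting_hyperplane K c H" "graph_hyperplane H l"
        by (rule graph_is_hyperplane[OF l(1)])
      show ?thesis
      proof (intro exI[of _ H] conjI subsetI ballI)
        show "x \<in> K_sphere K c \<phi> H" if "x \<in> S" for x using K_sphere_iff[OF H(2)] l(2) that by blast
        show "x \<notin> K_ball K c \<phi> H" if "x \<in> X - S" for x
          using K_ball_iff[OF H(2), of x] l(3) that by (metis not_le)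
      qed (fact H(1))
    qed
  qed
  note cells = this
  have "S \<subseteq> X \<and> (\<exists>H. cutting_hyperplane K c H \<and> S \<subseteq> K_sphere K c \<phi> H \<and> (\<forall>x\<in>X - S. x \<notin> K_ball K c \<phi> H))
    \<longleftrightarrow> lower_cell boundary_height X S" for S
    using cells[of S] by (auto simp: lower_cell_def)
  then show ?thesis unfolding K_Delaunay_def regular_subdivision_def by simp
qed

end

text \<open>Strict convexity places all of \<open>K\<close> except \<open>c\<close> strictly on one side of
  the supporting hyperplane at \<open>c\<close>, so that every point of \<open>K\<close> other than
  \<open>c\<close> lies on a projection ray.\<close>

lemma stereographic_chart_coordinates:
  assumes "smooth_body K" "strictly_convex_body K" "stereographic_chart K c \<phi>"
  obtains p L u \<tau> where "stereographic_coordinates K c \<phi> p L u \<tau>"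
proof -
  obtain p L H w where c: "c \<in> frontier K" and L: "linear L" "inj L"
    "\<phi> = (\<lambda>y. p + L y)"
    and H: "supporting_hyperplane K c H" "range \<phi> = (\<lambda>x. w + x) ` H"
      and nc: "c \<notin> range \<phi>"
    using assms(3) unfolding stereographic_chart_def by blast
  obtain v t where v: "v \<noteq> 0" "H = {y. v \<bullet> y = t}" "c \<in> H"
    "\<And>y. y \<in> K \<Longrightarrow> v \<bullet> y \<le> t"
    using H(1) unfolding supporting_hyperplane_def by blast
  have "closed K" using assms(1) by (auto simp: smooth_body_def convex_body_def compact_imp_closed)
  then have cK: "c \<in> K" using c by (auto simp: frontier_def)
  have vc: "v \<bullet> c = t" using v by blast
  have r: "range \<phi> = {z. (- v) \<bullet> (z - c) = - (v \<bullet> w)}"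
  proof (rule set_eqI)
    fix z
    have "z \<in> range \<phi> \<longleftrightarrow> z - w \<in> H"
      unfolding H(2) by (metis add_diff_cancel_left' diff_add_cancel image_iff)
    then show "z \<in> range \<phi> \<longleftrightarrow> z \<in> {z. (- v) \<bullet> (z - c) = - (v \<bullet> w)}"
      unfolding v(2) using vc by (auto simp: inner_diff_right)
  qed
  show ?thesis
  proof (rule that[of p L "- v" "- (v \<bullet> w)"], rule stereographic_coordinates.intro)
    show "- (v \<bullet> w) \<noteq> 0" using nc r by auto
    show "0 < - v \<bullet> (x - c)" if "x \<in> K" "x \<noteq> c" for x
    proof -
      have "v \<bullet> x \<noteq> t"
        using strictly_convex_support_unique[OF assms(2) v(1) v(4), of x c] that cK vc by blast
      then show ?thesis using v(4)[OF that(1)] vc by (simp add: inner_diff_right)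
    qed
  qed (fact assms c L r)+
qed

section \<open>Lex-liftings of neighborly polytopes\<close>

lemma affine_functional_fst_snd:
  assumes "affine_functional l"
  shows "affine_functional (\<lambda>z. l (fst z) + r * snd z)"
proof -
  obtain w b where "l = (\<lambda>x. w \<bullet> x + b)" using assms
    by (auto simp: affine_functional_def)
  then have "(\<lambda>z. l (fst z) + r * snd z) = (\<lambda>z. (w, r) \<bullet> z + b)"
    by (simp add: fun_eq_iff inner_prod_def)
  then show ?thesis unfolding affine_functional_def by blast
qed

text \<open>Points over an affinely spanning set whose heights are interpolated by \<open>q\<close> span the
  graph of \<open>q\<close>, a nonvertical hyperplane.\<close>

lemma affine_hull_lift:
  assumes q: "affine_functional q" and hull: "affine hull (a ` J) = UNIV"
    and J: "\<And>j. j \<in> J \<Longrightarrow> q (a j) = h j"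
  shows "affine hull (lift a h ` J) = {z. snd z = q (fst z)}"
proof -
  obtain w b where w: "q = (\<lambda>x. w \<bullet> x + b)" using q
    by (auto simp: affine_functional_def)
  let ?f = "\<lambda>x. (x, w \<bullet> x)"
  have f: "bounded_linear ?f"
    by (intro bounded_linear_Pair bounded_linear_ident bounded_linear_inner_right)
  have hj: "h j = w \<bullet> a j + b" if "j \<in> J" for j using J[OF that] by (simp add: w)
  have "lift a h ` J = (\<lambda>z. (0, b) + z) ` (?f ` (a ` J))"
    unfolding image_image by (intro image_cong refl) (simp add: lift_def hj)
  then have "affine hull (lift a h ` J) = (\<lambda>z. (0, b) + z) ` (affine hull (?f ` (a ` J)))"
    by (simp only: affine_hull_translation)
  also have "\<dots> = (\<lambda>z. (0, b) + z) ` (?f ` UNIV)"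
    using affine_hull_linear_image[OF f, of "a ` J"] unfolding hull by simp
  also have "\<dots> = {z. snd z = q (fst z)}"
  proof (rule set_eqI)
    fix z :: "'a \<times> real"
    show "z \<in> (\<lambda>z. (0, b) + z) ` (?f ` UNIV) \<longleftrightarrow> z \<in> {z. snd z = q (fst z)}"
      unfolding image_image w by (cases z) (auto simp: image_iff)
  qed
  finally show ?thesis .
qed

lemma above_graph:
  assumes "above_hyperplane p {z. snd z = q (fst z)}"
  shows "snd p > q (fst p)"
proof -
  obtain v t where v: "snd v > 0" "{z. snd z = q (fst z)} = {x. x \<bullet> v = t}"
    "p \<bullet> v > t"
    using assms unfolding above_hyperplane_def by blast
  have "(fst p, q (fst p)) \<in> {x. x \<bullet> v = t}" unfolding v(2)[symmetric] by simp
  then have "q (fst p) * snd v < snd p * snd v" using v(3) by (simp add: inner_prod_def)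
  then show ?thesis using v(1) by simp
qed

lemma below_graph:
  assumes "below_hyperplane p {z. snd z = q (fst z)}"
  shows "snd p < q (fst p)"
proof -
  obtain v t where v: "snd v > 0" "{z. snd z = q (fst z)} = {x. x \<bullet> v = t}"
    "p \<bullet> v < t"
    using assms unfolding below_hyperplane_def by blast
  have "(fst p, q (fst p)) \<in> {x. x \<bullet> v = t}" unfolding v(2)[symmetric] by simp
  then have "q (fst p) * snd v > snd p * snd v" using v(3) by (simp add: inner_prod_def)
  then show ?thesis using v(1) by simp
qed

lemma hyperplane_graph:
  assumes "affine_functional q"
  shows "hyperplane {z. snd z = q (fst z)}"
proof -
  obtain w b where w: "q = (\<lambda>x. w \<bullet> x + b)" using assms
    by (auto simp: affine_functional_def)
  have "{z. snd z = q (fst z)} = {z. (- w, 1) \<bullet> z = b}"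
    unfolding w by (auto simp: inner_prod_def)
  moreover have "(- w, 1::real) \<noteq> 0" by (simp add: zero_prod_def)
  ultimately show ?thesis unfolding hyperplane_def by blast
qed

locale neighborly_lifting =
  fixes a :: "nat \<Rightarrow> 'a::euclidean_space" and h :: "nat \<Rightarrow> real"
    and P :: "'a set" and n k :: nat
  assumes n: "n \<ge> DIM('a) + 2" and inj: "inj_on a {1..n}"
    and gp: "general_position (a ` {1..n})"
    and neighborly: "neighborly_polytope k P" and verts: "vertices P = a ` {1..n}"
    and lex: "lex_lifting n a h"
begin

abbreviation pt :: "nat \<Rightarrow> 'a \<times> real" where "pt \<equiv> lift a h"

lemma inj_pt: "inj_on pt {1..n}"
proof (rule inj_onI)
  fix i j assume *: "i \<in> {1..n}" "j \<in> {1..n}" "pt i = pt j"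
  then have "a i = a j" by (simp add: lift_def)
  then show "i = j" using inj_onD[OF inj] *(1,2) by blast
qed

lemma card_a: "J \<subseteq> {1..n} \<Longrightarrow> card (a ` J) = card J"
  by (rule card_image[OF inj_on_subset[OF inj]])

lemma card_pt: "J \<subseteq> {1..n} \<Longrightarrow> card (pt ` J) = card J"
  by (rule card_image[OF inj_on_subset[OF inj_pt]])

lemma base_independent:
  assumes "J \<subseteq> {1..n}" "card J \<le> DIM('a) + 1"
  shows "\<not> affine_dependent (a ` J)"
proof (rule general_position_independent_le[OF gp image_mono[OF assms(1)]])
  show "DIM('a) + 1 \<le> card (a ` {1..n})" using n card_a[OF subset_refl] by simp
  show "card (a ` J) \<le> DIM('a) + 1" using assms(2) card_a[OF assms(1)] by simp
qed simp

lemma base_spans: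
  assumes "J \<subseteq> {1..n}" "card J \<ge> DIM('a) + 1"
  shows "affine hull (a ` J) = UNIV"
proof -
  have "general_position (a ` J)"
    by (rule general_position_subset[OF gp image_mono[OF assms(1)]])
  then show ?thesis using assms(2)
    by (intro general_position_spans) (simp_all add: card_a[OF assms(1)])
qed

text \<open>The heights of the lifting as a function of the base point, so that affine minorants of them
  can be considered.\<close>

definition height :: "'a \<Rightarrow> real" where "height z = h (inv_into {1..n} a z)"

lemma height_a: "j \<in> {1..n} \<Longrightarrow> height (a j) = h j"
  unfolding height_def by (subst inv_into_f_f[OF inj]) auto

text \<open>This is the form in which the lex-lifting condition is used: instead of spanned hyperplanes
  it speaks about affine interpolants of earlier heights.\<close>

lemma lex_side:
  assumes i: "i \<in> {DIM('a) + 2..n}" and J: "J \<subseteq> {1..<i}" and q: "affine_functional q"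
    and hull: "affine hull (a ` J) = UNIV"
      and qJ: "\<And>j. j \<in> J \<Longrightarrow> q (a j) = h j"
  shows "sgn (h i) * (h i - q (a i)) > 0"
proof -
  let ?H = "{z. snd z = q (fst z)}"
  have "pt ` J \<subseteq> pt ` {1..<i}" using J by (rule image_mono)
  then have "spanned_hyperplane (pt ` {1..<i}) ?H"
    unfolding spanned_hyperplane_def
    using hyperplane_graph[OF q] affine_hull_lift[OF q hull qJ] by blast
  then have "h i \<noteq> 0" "h i > 0 \<Longrightarrow> above_hyperplane (pt i) ?H"
    "h i < 0 \<Longrightarrow> below_hyperplane (pt i) ?H"
    using bspec[OF lex[unfolded lex_lifting_def] i] by blast+
  then have "h i \<noteq> 0" "h i > 0 \<Longrightarrow> h i > q (a i)"
    "h i < 0 \<Longrightarrow> h i < q (a i)"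
    using above_graph[of "pt i" q] below_graph[of "pt i" q] by (simp_all add: lift_def)
  then show ?thesis by (cases "h i > 0") (auto simp: sgn_if)
qed

text \<open>The last point lies off the hyperplane spanned by the lifts of the others, and these are
  independent since their projections are.\<close>

lemma general_position_lift: "general_position (pt ` {1..n})"
proof (rule general_positionI)
  fix S assume S: "S \<subseteq> pt ` {1..n}" "card S = DIM('a \<times> real) + 1"
  obtain J where J: "J \<subseteq> {1..n}" "S = pt ` J" using S(1) by (auto simp: subset_image_iff)
  have cJ: "card J = DIM('a) + 2" using S(2) J by (simp add: card_pt)
  have fJ: "finite J" "J \<noteq> {}" using J(1) cJ finite_subset by auto
  define i where "i = Max J"
  have iJ: "i \<in> J" "\<And>j. j \<in> J \<Longrightarrow> j \<le> i" using fJ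
    by (auto simp: i_def)
  have "J \<subseteq> {1..i}" using iJ(2) J(1) by auto
  then have "DIM('a) + 2 \<le> i" using card_mono[of "{1..i}" J] cJ by simp
  then have i: "i \<in> {DIM('a) + 2..n}" using iJ(1) J(1) by auto
  let ?J = "J - {i}"
  have J': "?J \<subseteq> {1..<i}" using iJ(2) J(1) by (auto simp: less_le)
  have J'n: "?J \<subseteq> {1..n}" using J(1) by blast
  have cJ': "card ?J = DIM('a) + 1" using cJ iJ(1) fJ by simp
  have ind: "\<not> affine_dependent (a ` ?J)" using base_independent[OF J'n] cJ' by simp
  have hull: "affine hull (a ` ?J) = UNIV" using base_spans[OF J'n] cJ' by simp
  obtain q where q: "affine_functional q" "\<forall>z\<in>a ` ?J. q z = height z"
    using affine_interpolation[OF ind] by blast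
  have qJ: "q (a j) = h j" if "j \<in> ?J" for j
  proof -
    have "q (a j) = height (a j)" using q(2) that by blast
    then show ?thesis using height_a that J'n by auto
  qed
  have "h i \<noteq> q (a i)" using lex_side[OF i J' q(1) hull qJ] by auto
  moreover have "affine hull (pt ` ?J) = {z. snd z = q (fst z)}"
    by (rule affine_hull_lift[OF q(1) hull]) (rule qJ)
  ultimately have "pt i \<notin> affine hull (pt ` ?J)" by (simp add: lift_def)
  moreover have "\<not> affine_dependent (pt ` ?J)"
  proof -
    have "fst ` (pt ` ?J) = a ` ?J" by (simp add: image_image lift_def)
    then have "aff_dim (a ` ?J) \<le> aff_dim (pt ` ?J)"
      using aff_dim_linear_image_le[OF linear_fst] by metis
    moreover have "aff_dim (a ` ?J) = int (DIM('a))" using hull aff_dim_eq_full by blast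
    moreover have "aff_dim (pt ` ?J) \<le> int (card (pt ` ?J)) - 1" using fJ
      by (intro aff_dim_le_card) simp
    ultimately show ?thesis using cJ' fJ by (simp add: affine_independent_iff_card card_pt[OF J'n])
  qed
  ultimately have "\<not> affine_dependent (insert (pt i) (pt ` ?J))"
    by (intro affine_independent_insert)
  moreover have "S = insert (pt i) (pt ` ?J)" using J(2) iJ(1) by blast
  ultimately show "\<not> affine_dependent S" by simp
qed

lemma lift_independent:
  assumes "J \<subseteq> {1..n}" "card J \<le> DIM('a) + 2"
  shows "\<not> affine_dependent (pt ` J)"
proof (rule general_position_independent_le[OF general_position_lift image_mono[OF assms(1)]])
  show "DIM('a \<times> real) + 1 \<le> card (pt ` {1..n})" using n card_pt[OF subset_refl] by simp
  show "card (pt ` J) \<le> DIM('a \<times> real) + 1" using assms(2) card_pt[OF assms(1)] by simp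
qed simp

lemma lift_spans:
  assumes "J \<subseteq> {1..n}" "card J \<ge> DIM('a) + 2"
  shows "affine hull (pt ` J) = UNIV"
proof -
  have "general_position (pt ` J)"
    by (rule general_position_subset[OF general_position_lift image_mono[OF assms(1)]])
  then show ?thesis using assms(2)
    by (intro general_position_spans) (simp_all add: card_pt[OF assms(1)])
qed

text \<open>Faces of a polytope are exposed. A vertex of \<open>P\<close> in the face is a vertex of the face,
  hence belongs to the chosen \<open>k\<close> points.\<close>

lemma face_functional:
  assumes S: "S \<subseteq> {1..n}" "card S = k"
  obtains g where "affine_functional g" "\<And>j. j \<in> S \<Longrightarrow> g (a j) = 0"
    "\<And>j. j \<in> {1..n} - S \<Longrightarrow> g (a j) < 0"
proof -
  have "a ` S \<subseteq> vertices P" "card (a ` S) = k" using verts S by (auto simp: card_a)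
  then obtain G where G: "G face_of P" "vertices G = a ` S"
    using neighborly unfolding neighborly_polytope_def by blast
  have "polyhedron P" using neighborly polytope_imp_polyhedron
    by (auto simp: neighborly_polytope_def)
  then have "G exposed_face_of P" using G(1) exposed_face_of_polyhedron by blast
  then obtain w t where w: "P \<subseteq> {x. w \<bullet> x \<le> t}"
    "G = P \<inter> {x. w \<bullet> x = t}"
    unfolding exposed_face_of_def by blast
  have ext: "a j extreme_point_of P" if "j \<in> {1..n}" for j using verts that
    by (auto simp: vertices_def)
  then have aP: "a j \<in> P" if "j \<in> {1..n}" for j using that
    by (auto simp: extreme_point_of_def)
  have aG: "a j \<in> G \<longleftrightarrow> j \<in> S" if j: "j \<in> {1..n}" for j
  proof -
    have "a j \<in> G \<longleftrightarrow> a j \<in> vertices G"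
      using extreme_point_of_face[OF G(1), of "a j"] ext[OF j] by (simp add: vertices_def)
    also have "\<dots> \<longleftrightarrow> j \<in> S" unfolding G(2)
      using inj_on_image_mem_iff[OF inj j S(1)] .
    finally show ?thesis .
  qed
  show ?thesis
  proof (rule that[of "\<lambda>x. w \<bullet> x + (- t)"])
    show "affine_functional (\<lambda>x. w \<bullet> x + (- t))" unfolding affine_functional_def by blast
    show "w \<bullet> a j + - t = 0" if "j \<in> S" for j
    proof -
      have "a j \<in> G" using aG that S(1) by blast
      then show ?thesis using w(2) by simp
    qed
    show "w \<bullet> a j + - t < 0" if "j \<in> {1..n} - S" for j
    proof -
      have "a j \<notin> G" "a j \<in> P" using aG aP that by blast+
      then have "w \<bullet> a j \<noteq> t" "w \<bullet> a j \<le> t" using w by auto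
      then show ?thesis by simp
    qed
  qed
qed

text \<open>When \<open>k < n\<close> the face functional is not constant, so by general position it cannot
  vanish at \<open>DIM('a) + 1\<close> points.\<close>

lemma face_card:
  assumes S: "S \<subseteq> {1..n}" "card S = k" and "k < n"
  shows "k \<le> DIM('a)"
proof (rule ccontr)
  assume "\<not> k \<le> DIM('a)"
  then have hull: "affine hull (a ` S) = UNIV" using base_spans S by simp
  obtain g where g: "affine_functional g" "\<And>j. j \<in> S \<Longrightarrow> g (a j) = 0"
    "\<And>j. j \<in> {1..n} - S \<Longrightarrow> g (a j) < 0" using face_functional[OF S] by blast
  have "S \<noteq> {1..n}" using S \<open>k < n\<close> by auto
  then obtain j where j: "j \<in> {1..n} - S" using S(1) by blast
  have "g (a j) = 0"
  proof (rule affine_functional_eq_hull[OF g(1) affine_functional_const])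
    show "a j \<in> affine hull (a ` S)" using hull by simp
  qed (use g(2) in auto)
  then show False using g(3)[OF j] by simp
qed

text \<open>The hyperplane \<open>g = 0\<close> supports the hull of the earlier points in a face that
  contains the lifts of \<open>S\<close> and is visible from the new point. Suppose \<open>h i > 0\<close>. As
  \<open>S\<close> is the vertex set of a face of \<open>P\<close>, its lifts lie on the upper hull of the
  earlier points, since a steep hyperplane through them passes above all the others. It can be moved to one
  that is spanned by earlier points, and the new point is above that one. If \<open>h i < 0\<close>, the same
  argument applies to the lower hull; the sign \<open>s\<close> treats both cases at once.\<close>

lemma visible_functional:
  assumes i: "i \<in> {DIM('a) + 2..n}" and S: "S \<subseteq> {1..<i}" "card S = k"
  obtains g where "affine_functional g" "\<And>j. j \<in> S \<Longrightarrow> g (pt j) = 0"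
    "\<And>j. j \<in> {1..<i} \<Longrightarrow> g (pt j) \<le> 0" "g (pt i) > 0"
proof -
  let ?X = "a ` {1..<i}"
  define s where "s = sgn (h i)"
  have iS: "{1..<i} \<subseteq> {1..n}" using i by auto
  have Sn: "S \<subseteq> {1..n}" using S(1) iS by blast
  have "DIM('a) + 1 \<le> i - 1" using i by auto
  then have "DIM('a) + 1 \<le> card {1..<i}" by simp
  then have hullX: "affine hull ?X = UNIV" by (rule base_spans[OF iS])
  have "k < n" using card_mono[OF finite_atLeastLessThan S(1)] S(2) i by auto
  then have kd: "card S \<le> DIM('a) + 1" using face_card[OF Sn S(2)] S(2) by simp
  obtain g where g: "affine_functional g" "\<And>j. j \<in> S \<Longrightarrow> g (a j) = 0"
    "\<And>j. j \<in> {1..n} - S \<Longrightarrow> g (a j) < 0" using face_functional[OF Sn S(2)]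
    by blast
  have "lower_cell (\<lambda>z. - s * height z) ?X (a ` S)"
  proof (rule exposed_lower_cell[OF _ _ _ g(1)])
    show "\<not> affine_dependent (a ` S)" using base_independent[OF Sn kd] .
    show "g x = 0" if "x \<in> a ` S" for x using g(2) that by blast
    show "g x < 0" if "x \<in> ?X - a ` S" for x using g(3) that iS by blast
  qed (use S in auto)
  then obtain l0 where l0: "minorizes l0 ?X (\<lambda>z. - s * height z)"
    "tight_points (\<lambda>z. - s * height z) ?X l0 = a ` S" by (rule lower_cell_minorizes)
  have "1 \<in> {1..<i}" using i by simp
  then have y: "a 1 \<in> convex hull ?X" by (intro hull_inc imageI)
  have "finite ?X" by simp
  then obtain l where l: "minorizes l ?X (\<lambda>z. - s * height z)"
    "tight_points (\<lambda>z. - s * height z) ?X l0 \<subseteq> tight_points (\<lambda>z. - s * height z) ?X l"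
    "affine hull (tight_points (\<lambda>z. - s * height z) ?X l) = UNIV"
    by (rule spanning_minorant[OF _ hullX y l0(1)])
  have la: "affine_functional l" using l(1) by (simp add: minorizes_def)
  have ha: "height (a j) = h j" if "j \<in> {1..<i}" for j using height_a iS that by blast
  have le: "l (a j) \<le> - s * h j" if j: "j \<in> {1..<i}" for j
  proof -
    have "l (a j) \<le> - s * height (a j)" using l(1) j unfolding minorizes_def by blast
    then show ?thesis unfolding ha[OF j] .
  qed
  define J where "J = {j \<in> {1..<i}. l (a j) = - s * h j}"
  have tight: "tight_points (\<lambda>z. - s * height z) ?X l = a ` J"
  proof (rule set_eqI)
    fix x
    have "x \<in> tight_points (\<lambda>z. - s * height z) ?X l \<longleftrightarrow> (\<exists>j\<in>{1..<i}. x = a j \<and> l (a j) = - s * height (a j))"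
      unfolding tight_points_def by blast
    also have "\<dots> \<longleftrightarrow> (\<exists>j\<in>{1..<i}. x = a j \<and> l (a j) = - s * h j)"
      by (intro bex_cong refl) (simp only: ha)
    also have "\<dots> \<longleftrightarrow> x \<in> a ` J" unfolding J_def by blast
    finally show "x \<in> tight_points (\<lambda>z. - s * height z) ?X l \<longleftrightarrow> x \<in> a ` J" .
  qed
  have hullJ: "affine hull (a ` J) = UNIV" using l(3) unfolding tight .
  have SJ: "a ` S \<subseteq> a ` J" using l(2) unfolding tight l0(2) .
  have "h i \<noteq> 0" using bspec[OF lex[unfolded lex_lifting_def] i] by blast
  then have ss: "s * s = 1" by (simp add: s_def sgn_if)
  have "s * (h i - (- s) * l (a i)) > 0"
    unfolding s_def
  proof (rule lex_side[OF i _ _ hullJ])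
    show "J \<subseteq> {1..<i}" by (auto simp: J_def)
    show "affine_functional (\<lambda>x. - sgn (h i) * l x)" using la
      by (rule affine_functional_scale)
    show "- sgn (h i) * l (a j) = h j" if "j \<in> J" for j
    proof -
      have "l (a j) = - s * h j" using that by (simp add: J_def)
      then have "- s * l (a j) = (s * s) * h j" by simp
      then have "- s * l (a j) = h j" unfolding ss by simp
      then show ?thesis unfolding s_def .
    qed
  qed
  then have "s * h i + (s * s) * l (a i) > 0" by (simp add: algebra_simps)
  then have pos: "l (a i) + s * h i > 0" unfolding ss by simp
  show ?thesis
  proof (rule that[of "\<lambda>z. l (fst z) + s * snd z"])
    show "affine_functional (\<lambda>z. l (fst z) + s * snd z)" using la
      by (rule affine_functional_fst_snd)
    show "l (fst (pt i)) + s * snd (pt i) > 0" using pos by (simp add: lift_def)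
    show "l (fst (pt j)) + s * snd (pt j) \<le> 0" if "j \<in> {1..<i}" for j
      using le[OF that] by (simp add: lift_def)
    show "l (fst (pt j)) + s * snd (pt j) = 0" if "j \<in> S" for j
    proof -
      have "a j \<in> a ` J" using SJ that by blast
      then obtain j' where j': "a j = a j'" "j' \<in> J" by (rule imageE)
      have "j \<in> {1..n}" "j' \<in> {1..n}" using j'(2) iS Sn that by (auto simp: J_def)
      with j'(1) have "j = j'" by (rule inj_onD[OF inj])
      then have "l (a j) = - s * h j" using j'(2) unfolding J_def by blast
      then show ?thesis by (simp add: lift_def)
    qed
  qed
qed

text \<open>Among more than \<open>DIM('a) + 2\<close> points of a cell, the functional of the cell
  interpolates \<open>F\<close> on independent points that precede the last one, which therefore lies strictly
  above it.\<close>

lemma lower_cells_independent: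
  assumes outside: "\<And>i B l. i \<in> {DIM('a) + 3..n} \<Longrightarrow> B \<subseteq> pt ` {1..<i} \<Longrightarrow> card B = DIM('a) + 2 \<Longrightarrow>
      \<not> affine_dependent B \<Longrightarrow> affine_functional l \<Longrightarrow> \<forall>b\<in>B. l b = F b \<Longrightarrow> l (pt i) < F (pt i)"
    and S: "lower_cell F (pt ` {1..n}) S"
  shows "\<not> affine_dependent S"
proof -
  obtain l where l: "affine_functional l" "S \<subseteq> pt ` {1..n}" "\<forall>x\<in>S. l x = F x"
    using S unfolding lower_cell_def by blast
  obtain J where J: "J \<subseteq> {1..n}" "S = pt ` J" using l(2) by (auto simp: subset_image_iff)
  have "card J \<le> DIM('a) + 2"
  proof (rule ccontr)
    assume "\<not> card J \<le> DIM('a) + 2"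
    then have cJ: "card J \<ge> DIM('a) + 3" by simp
    have fJ: "finite J" "J \<noteq> {}" using J(1) cJ finite_subset by auto
    define i where "i = Max J"
    have iJ: "i \<in> J" "\<And>j. j \<in> J \<Longrightarrow> j \<le> i" using fJ
      by (auto simp: i_def)
    have "J \<subseteq> {1..i}" using iJ(2) J(1) by auto
    then have "DIM('a) + 3 \<le> i" using card_mono[of "{1..i}" J] cJ by simp
    then have i: "i \<in> {DIM('a) + 3..n}" using iJ(1) J(1) by auto
    have "card (J - {i}) \<ge> DIM('a) + 2" using cJ iJ(1) fJ by simp
    then obtain J' where J': "J' \<subseteq> J - {i}" "card J' = DIM('a) + 2"
      by (rule obtain_subset_with_card_n)
    have J'i: "J' \<subseteq> {1..<i}" using J'(1) iJ(2) J(1) by (fastforce simp: less_le)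
    have J'n: "J' \<subseteq> {1..n}" using J'(1) J(1) by blast
    have "l (pt i) < F (pt i)"
    proof (rule outside[OF i])
      show "pt ` J' \<subseteq> pt ` {1..<i}" using J'i by (rule image_mono)
      show "card (pt ` J') = DIM('a) + 2" using J'(2) card_pt[OF J'n] by simp
      show "\<not> affine_dependent (pt ` J')" using lift_independent[OF J'n] J'(2) by simp
      show "\<forall>b\<in>pt ` J'. l b = F b" using l(3) J(2) J'(1) by blast
    qed (fact l(1))
    moreover have "l (pt i) = F (pt i)" using l(3) J(2) iJ(1) by blast
    ultimately show False by simp
  qed
  then show ?thesis using lift_independent[OF J(1)] J(2) by simp
qed

text \<open>The hypothesis \<open>outside\<close> says that \<open>F\<close> lifts each point after the first
  \<open>DIM('a) + 2\<close> above all hyperplanes spanned by the lifts of its predecessors, so the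
  subdivision grows by joining each new point to the faces that it sees. If the new point is not in
  \<open>S\<close>, the cell \<open>S\<close> survives: a spanning minorant that is tight on \<open>S\<close>
  is strictly below \<open>F\<close> at the new point, and a convex combination with the old minorant keeps
  the old strictness as well. If it is in \<open>S\<close>, the other \<open>k\<close> points form a face of
  \<open>P\<close>, hence a cell; adding a multiple of the functional of a visible face raises the minorant at
  the new point until it is tight there.\<close>

lemma neighborly_lower_cells:
  assumes outside: "\<And>i B l. i \<in> {DIM('a) + 3..n} \<Longrightarrow> B \<subseteq> pt ` {1..<i} \<Longrightarrow> card B = DIM('a) + 2 \<Longrightarrow>
      \<not> affine_dependent B \<Longrightarrow> affine_functional l \<Longrightarrow> \<forall>b\<in>B. l b = F b \<Longrightarrow> l (pt i) < F (pt i)"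
    and "DIM('a) + 2 \<le> i" "i \<le> n" "S \<subseteq> {1..i}" "card S = k + 1"
  shows "lower_cell F (pt ` {1..i}) (pt ` S)"
  using assms(2-)
proof (induction i arbitrary: S rule: nat_induct_at_least)
  case base
  let ?X = "pt ` {1..DIM('a) + 2}"
  have ind: "\<not> affine_dependent ?X" using lift_independent[of "{1..DIM('a) + 2}"] base by simp
  then obtain l where "affine_functional l" "\<forall>x\<in>?X. l x = F x"
    using affine_interpolation by blast
  then have "lower_cell F ?X ?X" by (intro lower_cellI[of l]) auto
  then show ?case using lower_cell_subset[OF _ _ ind] base(2) by (simp add: image_mono)
next
  case (Suc i)
  let ?X = "pt ` {1..i}" and ?p = "pt (Suc i)"
  have X: "pt ` {1..Suc i} = insert ?p ?X" by (simp add: atLeastAtMostSuc_conv)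
  have in1: "{1..i} \<subseteq> {1..n}" using Suc.prems(1) by auto
  have fX: "finite ?X" by simp
  show ?case
  proof (cases "Suc i \<in> S")
    case False
    have S: "S \<subseteq> {1..i}" using Suc.prems(2) False by (auto simp: le_Suc_eq)
    have "lower_cell F ?X (pt ` S)" using Suc.IH[OF _ S Suc.prems(3)] Suc.prems(1) by simp
    then obtain l0 where l0: "minorizes l0 ?X F" "tight_points F ?X l0 = pt ` S"
      by (rule lower_cell_minorizes)
    have hullX: "affine hull ?X = UNIV" using lift_spans[OF in1] Suc.hyps by simp
    have "1 \<in> {1..i}" using Suc.hyps by simp
    then have y: "pt 1 \<in> convex hull ?X" by (intro hull_inc imageI)
    obtain l1 where l1: "minorizes l1 ?X F" "tight_points F ?X l0 \<subseteq> tight_points F ?X l1"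
      "affine hull (tight_points F ?X l1) = UNIV"
      by (rule spanning_minorant[OF fX hullX y l0(1)])
    have aff: "affine_functional l0" "affine_functional l1" using l0(1) l1(1)
      by (simp_all add: minorizes_def)
    obtain B where B: "B \<subseteq> tight_points F ?X l1" "\<not> affine_dependent B"
      "affine hull B = UNIV"
      using affine_basis_exists[of "tight_points F ?X l1"] l1(3) by auto
    have "aff_dim B = int (DIM('a \<times> real))" using B(3) aff_dim_eq_full by blast
    then have cB: "card B = DIM('a) + 2" using aff_dim_affine_independent[OF B(2)] by simp
    have p: "l1 ?p < F ?p"
    proof (rule outside[OF _ _ cB B(2) aff(2)])
      show "Suc i \<in> {DIM('a) + 3..n}" using Suc.hyps Suc.prems(1) by simp
      show "B \<subseteq> pt ` {1..<Suc i}" using B(1)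
        by (auto simp: tight_points_def atLeastLessThanSuc_atLeastAtMost)
      show "\<forall>b\<in>B. l1 b = F b" using B(1) by (auto simp: tight_points_def)
    qed
    \<comment> \<open>A little of the old minorant restores strictness at the points where \<open>l1\<close> became tight.\<close>
    obtain e where e: "0 < e" "e < 1" "l1 ?p - F ?p + e * (l0 ?p - l1 ?p) < 0"
      using small_perturbation[of "{?p}" "\<lambda>z. l1 z - F z"
        "\<lambda>z. l0 z - l1 z"] p by auto
    show ?thesis
    proof (rule lower_cellI[of "\<lambda>z. (1 - e) * l1 z + e * l0 z"])
      show "affine_functional (\<lambda>z. (1 - e) * l1 z + e * l0 z)"
        by (intro affine_functional_add affine_functional_scale aff)
      show "pt ` S \<subseteq> pt ` {1..Suc i}" using Suc.prems(2) by (rule image_mono)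
      show "(1 - e) * l1 z + e * l0 z = F z" if "z \<in> pt ` S" for z
      proof -
        have "z \<in> tight_points F ?X l0" "z \<in> tight_points F ?X l1" using that l0(2) l1(2)
          by auto
        then have "l0 z = F z" "l1 z = F z" by (simp_all add: tight_points_def)
        then show ?thesis by (simp add: algebra_simps)
      qed
      show "(1 - e) * l1 z + e * l0 z < F z" if z: "z \<in> pt ` {1..Suc i} - pt ` S" for z
      proof (cases "z = ?p")
        case True
        then show ?thesis using e(3) by (simp add: algebra_simps)
      next
        case False
        then have zX: "z \<in> ?X" using z X by blast
        then have "l1 z \<le> F z" using l1(1) unfolding minorizes_def by blast
        then have "(1 - e) * l1 z \<le> (1 - e) * F z" using e(2) by (intro mult_left_mono) auto
        moreover have "l0 z < F z"
        proof -
          have "z \<notin> tight_points F ?X l0" using z l0(2) by blast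
          moreover have "l0 z \<le> F z" using l0(1) zX unfolding minorizes_def by blast
          ultimately show ?thesis using zX unfolding tight_points_def by force
        qed
        then have "e * l0 z < e * F z" using e(1) by simp
        ultimately have "(1 - e) * l1 z + e * l0 z < (1 - e) * F z + e * F z" by linarith
        then show ?thesis by (simp add: algebra_simps)
      qed
    qed
  next
    case True
    let ?S = "S - {Suc i}"
    have S: "?S \<subseteq> {1..<Suc i}" using Suc.prems(2) by (auto simp: less_Suc_eq_le le_Suc_eq)
    have Sn: "?S \<subseteq> {1..n}" using S in1 by auto
    have cS: "card ?S = k"
      using True Suc.prems(3) by simp
    have "k < n" using card_mono[OF finite_atLeastAtMost Suc.prems(2)] Suc.prems(1,3) by simp
    then have kd: "card ?S \<le> DIM('a) + 2" using face_card[OF Sn cS] cS by simp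
    obtain g where g: "affine_functional g" "\<And>j. j \<in> ?S \<Longrightarrow> g (a j) = 0"
      "\<And>j. j \<in> {1..n} - ?S \<Longrightarrow> g (a j) < 0" using face_functional[OF Sn cS]
      by blast
    have "lower_cell F (pt ` {1..Suc i}) (pt ` ?S)"
    proof (rule exposed_lower_cell[of _ _ "\<lambda>z. g (fst z) + 0 * snd z"])
      show "affine_functional (\<lambda>z. g (fst z) + 0 * snd z)" using g(1)
        by (rule affine_functional_fst_snd)
      show "\<not> affine_dependent (pt ` ?S)" using lift_independent[OF Sn kd] .
      show "pt ` ?S \<subseteq> pt ` {1..Suc i}" using Suc.prems(2) by (intro image_mono) auto
      show "g (fst x) + 0 * snd x = 0" if "x \<in> pt ` ?S" for x
      proof -
        obtain j where "j \<in> ?S" "x = pt j" using \<open>x \<in> pt ` ?S\<close> by blast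
        then show ?thesis using g(2)[of j] by (simp add: lift_def)
      qed
      show "g (fst x) + 0 * snd x < 0" if x: "x \<in> pt ` {1..Suc i} - pt ` ?S" for x
      proof -
        obtain j where j: "x = pt j" "j \<in> {1..Suc i}" "j \<notin> ?S" using x by blast
        then have "j \<in> {1..n} - ?S" using Suc.prems(1) by auto
        then show ?thesis using g(3) j(1) by (simp add: lift_def)
      qed
    qed simp
    then obtain l0 where l0: "affine_functional l0" "\<forall>x\<in>pt ` ?S. l0 x = F x"
      "\<forall>x\<in>pt ` {1..Suc i} - pt ` ?S. l0 x < F x" unfolding lower_cell_def by blast
    have "pt (Suc i) \<notin> pt ` ?S"
    proof
      assume "pt (Suc i) \<in> pt ` ?S"
      then obtain j where "j \<in> ?S" "pt (Suc i) = pt j" by blast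
      then show False using inj_onD[OF inj_pt, of "Suc i" j] Sn Suc.prems(1) by auto
    qed
    then have p: "l0 ?p < F ?p" using l0(3) by simp
    have "Suc i \<in> {DIM('a) + 2..n}" using Suc.hyps Suc.prems(1) by simp
    then obtain m where m: "affine_functional m"
      "\<And>j. j \<in> ?S \<Longrightarrow> m (pt j) = 0"
      "\<And>j. j \<in> {1..<Suc i} \<Longrightarrow> m (pt j) \<le> 0" "m ?p > 0"
      using visible_functional[OF _ S cS] by blast
    \<comment> \<open>The multiple that makes the new point tight.\<close>
    define t where "t = (F ?p - l0 ?p) / m ?p"
    have t: "t > 0" "t * m ?p = F ?p - l0 ?p" using p m(4) by (simp_all add: t_def)
    show ?thesis
    proof (rule lower_cellI[of "\<lambda>z. l0 z + t * m z"])
      show "affine_functional (\<lambda>z. l0 z + t * m z)"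
        by (intro affine_functional_add affine_functional_scale l0(1) m(1))
      show "pt ` S \<subseteq> pt ` {1..Suc i}" using Suc.prems(2) by (rule image_mono)
      show "l0 z + t * m z = F z" if z: "z \<in> pt ` S" for z
      proof (cases "z = ?p")
        case True then show ?thesis using t(2) by simp
      next
        case False
        then obtain j where "j \<in> ?S" "z = pt j" using z by blast
        then show ?thesis using m(2) l0(2) by simp
      qed
      show "l0 z + t * m z < F z" if z: "z \<in> pt ` {1..Suc i} - pt ` S" for z
      proof -
        obtain j where j: "z = pt j" "j \<in> {1..Suc i}" "j \<notin> S" using z by blast
        then have "j \<noteq> Suc i" using True by blast
        then have "j \<in> {1..<Suc i}" using j(2) by simp
        then have "t * m z \<le> 0" using m(3) j(1) t(1) by (simp add: mult_nonneg_nonpos)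
        moreover have "l0 z < F z" using l0(3) z by blast
        ultimately show ?thesis by simp
      qed
    qed
  qed
qed

text \<open>A lifted point in the hull of the others would project to a point in the hull of the others.\<close>

lemma lift_extreme: "vertices (convex hull (pt ` {1..n})) = pt ` {1..n}"
proof
  show "vertices (convex hull (pt ` {1..n})) \<subseteq> pt ` {1..n}"
    unfolding vertices_def by (rule extreme_points_of_convex_hull)
  have "pt i extreme_point_of (convex hull (pt ` {1..n}))" if i: "i \<in> {1..n}" for i
  proof -
    have "pt i \<notin> convex hull (pt ` {1..n} - {pt i})"
    proof
      assume "pt i \<in> convex hull (pt ` {1..n} - {pt i})"
      then have "fst (pt i) \<in> fst ` (convex hull (pt ` {1..n} - {pt i}))" by (rule imageI)
      then have "a i \<in> convex hull (fst ` (pt ` {1..n} - {pt i}))"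
        by (simp add: convex_hull_linear_image[OF linear_fst] lift_def)
      moreover have "fst ` (pt ` {1..n} - {pt i}) \<subseteq> P - {a i}"
      proof
        fix x assume "x \<in> fst ` (pt ` {1..n} - {pt i})"
        then obtain j where j: "x = fst (pt j)" "j \<in> {1..n}" "pt j \<noteq> pt i" by blast
        have "a j \<noteq> a i"
        proof
          assume "a j = a i"
          then have "j = i" using j(2) i by (rule inj_onD[OF inj])
          then show False using j(3) by simp
        qed
        moreover have "a j \<in> P"
        proof -
          have "a j \<in> vertices P" unfolding verts using j(2) by (rule imageI)
          then show ?thesis by (simp add: vertices_def extreme_point_of_def)
        qed
        ultimately show "x \<in> P - {a i}" using j(1) by (simp add: lift_def)
      qed
      moreover have "convex (P - {a i})"
      proof -
        have "a i \<in> vertices P" unfolding verts using i by (rule imageI)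
        then have "a i extreme_point_of P" by (simp add: vertices_def)
        moreover have "convex P" using neighborly polytope_imp_convex
          by (auto simp: neighborly_polytope_def)
        ultimately show ?thesis by (simp add: extreme_point_of_stillconvex)
      qed
      ultimately have "a i \<in> P - {a i}" using hull_minimal[of _ "P - {a i}" convex]
        by (meson subsetD)
      then show False by simp
    qed
    then have "pt i extreme_point_of (convex hull (insert (pt i) (pt ` {1..n} - {pt i})))"
      by (intro extreme_point_of_convex_hull_insert) simp_all
    moreover have "insert (pt i) (pt ` {1..n} - {pt i}) = pt ` {1..n}" using i by blast
    ultimately show ?thesis by (simp only:)
  qed
  then show "pt ` {1..n} \<subseteq> vertices (convex hull (pt ` {1..n}))"
    unfolding vertices_def by blast
qed

text \<open>The preimage of a face of \<open>P\<close> under the projection is a face of the hull of the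
  lifts.\<close>

lemma lift_neighborly: "neighborly_polytope k (convex hull (pt ` {1..n}))"
  unfolding neighborly_polytope_def lift_extreme
proof (intro conjI allI impI)
  let ?Q = "convex hull (pt ` {1..n})"
  show "polytope ?Q" by (simp add: polytope_convex_hull)
  fix T assume T: "T \<subseteq> pt ` {1..n}" "card T = k"
  obtain S where S: "S \<subseteq> {1..n}" "T = pt ` S" using T(1) by (auto simp: subset_image_iff)
  have cS: "card S = k" using T(2) S card_pt by simp
  obtain g where g: "affine_functional g" "\<And>j. j \<in> S \<Longrightarrow> g (a j) = 0"
    "\<And>j. j \<in> {1..n} - S \<Longrightarrow> g (a j) < 0" using face_functional[OF S(1) cS]
    by blast
  let ?g = "\<lambda>z. g (fst z) + 0 * snd z"
  have ag: "affine_functional ?g" using g(1) by (rule affine_functional_fst_snd)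
  then obtain w b where w: "?g = (\<lambda>z. w \<bullet> z + b)" unfolding affine_functional_def by blast
  have wg: "w \<bullet> z + b = g (fst z)" for z using fun_cong[OF w, of z] by simp
  have gpt: "g (a j) \<le> 0" if "j \<in> {1..n}" for j
    using g(2)[of j] g(3)[of j] that by (cases "j \<in> S") auto
  have le: "w \<bullet> z \<le> - b" if "z \<in> ?Q" for z
  proof -
    have "?g z \<le> 0"
      by (rule affine_functional_nonpos_hull[OF ag that]) (use gpt in \<open>auto simp: lift_def\<close>)
    then show ?thesis using wg[of z] by simp
  qed
  let ?G = "?Q \<inter> {z. w \<bullet> z = - b}"
  have face: "?G face_of ?Q"
    by (rule face_of_Int_supporting_hyperplane_le) (use le in auto)
  have mem: "pt j \<in> ?G \<longleftrightarrow> j \<in> S" if j: "j \<in> {1..n}" for j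
  proof -
    have "pt j \<in> ?Q" using j by (intro hull_inc imageI)
    moreover have "w \<bullet> pt j = - b \<longleftrightarrow> g (a j) = 0" using wg[of "pt j"]
      by (auto simp: lift_def)
    moreover have "g (a j) = 0 \<longleftrightarrow> j \<in> S" using g(2)[of j] g(3)[of j] j
      by (cases "j \<in> S") auto
    ultimately show ?thesis by simp
  qed
  have "v extreme_point_of ?G \<longleftrightarrow> v \<in> T" for v
  proof -
    have "v extreme_point_of ?G \<longleftrightarrow> v \<in> pt ` {1..n} \<and> v \<in> ?G"
      using extreme_point_of_face[OF face, of v] lift_extreme by (auto simp: vertices_def)
    also have "\<dots> \<longleftrightarrow> v \<in> T" using mem S by blast
    finally show ?thesis .
  qed
  then have "vertices ?G = T" by (simp add: vertices_def)
  then show "\<exists>G. G face_of ?Q \<and> vertices G = T" using face by blast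
qed

lemma neighborly_regular_subdivision:
  assumes outside: "\<And>i B l. i \<in> {DIM('a) + 3..n} \<Longrightarrow> B \<subseteq> pt ` {1..<i} \<Longrightarrow> card B = DIM('a) + 2 \<Longrightarrow>
      \<not> affine_dependent B \<Longrightarrow> affine_functional l \<Longrightarrow> \<forall>b\<in>B. l b = F b \<Longrightarrow> l (pt i) < F (pt i)"
  shows "neighborly_triangulation (k + 1) (pt ` {1..n}) (regular_subdivision F (pt ` {1..n}))"
  unfolding neighborly_triangulation_def
proof (intro conjI allI impI)
  show "triangulation_of (pt ` {1..n}) (regular_subdivision F (pt ` {1..n}))"
  proof (rule regular_subdivision_triangulation)
    show "affine hull (pt ` {1..n}) = UNIV" using lift_spans[of "{1..n}"] n by simp
    show "\<not> affine_dependent S" if "lower_cell F (pt ` {1..n}) S" for S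
      using lower_cells_independent[of F S] outside that by blast
  qed simp
  fix T assume T: "T \<subseteq> pt ` {1..n}" "card T = k + 1"
  obtain S where S: "S \<subseteq> {1..n}" "T = pt ` S" using T(1) by (auto simp: subset_image_iff)
  have "card S = k + 1" using T(2) S card_pt by simp
  then have "lower_cell F (pt ` {1..n}) T"
    unfolding S(2) using neighborly_lower_cells[of F n S] outside n S(1) by blast
  then show "convex hull T \<in> regular_subdivision F (pt ` {1..n})"
    unfolding regular_subdivision_def by blast
qed

end

section \<open>K-liftings of neighborly polytopes\<close>

theorem theorem5p3:
  fixes K :: "'e::euclidean_space set"
    and c :: 'e
    and \<phi> :: "'a::euclidean_space \<times> real \<Rightarrow> 'e"
    and a :: "nat \<Rightarrow> 'a"
    and h :: "nat \<Rightarrow> real"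
    and P :: "'a set"
    and n k :: nat
  assumes "DIM('e) = DIM('a) + 2"
    and "smooth_body K" and "strictly_convex_body K"
    and "stereographic_chart K c \<phi>"
    and "n \<ge> DIM('a) + 2"
    and "inj_on a {1..n}"
    and "general_position (a ` {1..n})"
    and "neighborly_polytope k P"
    and "aff_dim P = int DIM('a)"
    and "vertices P = a ` {1..n}"
    and "K_lifting K c \<phi> n a h"
  shows "neighborly_polytope k (convex hull (lift a h ` {1..n})) \<and>
         vertices (convex hull (lift a h ` {1..n})) = lift a h ` {1..n} \<and>
         neighborly_triangulation (k + 1) (lift a h ` {1..n})
           (K_Delaunay K c \<phi> (lift a h ` {1..n}))"
proof -
  obtain p L u \<tau> where coords: "stereographic_coordinates K c \<phi> p L u \<tau>"
    by (rule stereographic_chart_coordinates[OF assms(2-4)])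
  interpret stereographic_coordinates K c \<phi> p L u \<tau> by (fact coords)
  have lex: "lex_lifting n a h" using assms(11) by (simp add: K_lifting_def)
  interpret neighborly_lifting a h P n k
    by (rule neighborly_lifting.intro) (fact assms lex)+
  have outside: "l (lift a h i) < boundary_height (lift a h i)"
    if i: "i \<in> {DIM('a) + 3..n}" and B: "B \<subseteq> lift a h ` {1..<i}"
      "card B = DIM('a) + 2"
      "\<not> affine_dependent B" and l: "affine_functional l"
      "\<forall>b\<in>B. l b = boundary_height b" for i B l
  proof (rule ccontr)
    assume "\<not> l (lift a h i) < boundary_height (lift a h i)"
    then have "boundary_height (lift a h i) \<le> l (lift a h i)" by simp
    moreover have "affine hull B = UNIV" using affine_independent_iff_spans[of B] B(2,3) by simp
    moreover have "finite B" using B(3) by (rule aff_independent_finite)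
    ultimately have "lift a h i \<in> K_circumball K c \<phi> B"
      using below_in_circumball[of B l "lift a h i"] l by blast
    then show False using assms(11) i B unfolding K_lifting_def by blast
  qed
  have "neighborly_triangulation (k + 1) (lift a h ` {1..n}) (regular_subdivision boundary_height (lift a h ` {1..n}))"
    using outside by (rule neighborly_regular_subdivision)
  moreover have "K_Delaunay K c \<phi> (lift a h ` {1..n}) = regular_subdivision boundary_height (lift a h ` {1..n})"
    by (rule K_Delaunay_eq_regular_subdivision) simp
  ultimately show ?thesis using lift_neighborly lift_extreme by simp
qed

end
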